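(* Let $f$ satisfy (f1) and suppose $f_0\in(0,+\infty)$ and $f_\infty\in(0,+\infty)$. Then for every $\lambda$ in the open interval with endpoints $\lambda_1/f_\infty$ and $\lambda_1/f_0$ (i.e. $\lambda\in(\lambda_1/f_\infty,\lambda_1/f_0)$ or $\lambda\in(\lambda_1/f_0,\lambda_1/f_\infty)$), problem (MO) has two solutions $u^+$ and $u^-$ such that $u^+$ is positive and strictly concave in $(0,1)$ and $u^-$ is negative and strictly convex in $(0,1)$.
   Context: Let $N\ge 1$ be an integer and $f:\mathbb{R}\to\mathbb{R}$ continuous. For $\lambda\ge 0$, problem (MO) is: find $u\in C^2[0,1]$ with $\left((u'(r))^N\right)'=\lambda^N N r^{N-1} f(-u(r))$ for $0<r<1$ and $u'(0)=u(1)=0$. Condition (f1): $f\in C(\mathbb{R},\mathbb{R})$ and $f(s)s^N>0$ for all $s\neq0$. The quantities $f_0,f_\infty\in[0,+\infty]$ are defined by $f_0^N=\lim_{s\to0} f(s)/s^N$ and $f_\infty^N=\lim_{|s|\to+\infty} f(s)/s^N$ (these limits are assumed to exist in $[0,+\infty]$; $f_0=\infty$ means the limit is $+\infty$, etc.). $\lambda_1>0$ denotes the first eigenvalue of the problem $\left((-v')^N\right)'=\lambda^N N r^{N-1}v^N$ in $(0,1)$, $v'(0)=v(1)=0$, i.e. the unique $\lambda>0$ for which this problem has a solution $v\in C^2[0,1]$ positive in $(0,1)$ (this eigenvalue is simple). *)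

theory Defs
  imports "HOL-Analysis.Analysis"
begin

definition strictly_convex_on :: "real set \<Rightarrow> (real \<Rightarrow> real) \<Rightarrow> bool" where
  "strictly_convex_on S g \<longleftrightarrow> convex S \<and>
    (\<forall>x\<in>S. \<forall>y\<in>S. \<forall>t. x \<noteq> y \<and> 0 < t \<and> t < 1 \<longrightarrow>
       g ((1 - t) * x + t * y) < (1 - t) * g x + t * g y)"

definition strictly_concave_on :: "real set \<Rightarrow> (real \<Rightarrow> real) \<Rightarrow> bool" where
  "strictly_concave_on S g \<longleftrightarrow> strictly_convex_on S (\<lambda>x. - g x)"

definition MO_solution :: "nat \<Rightarrow> (real \<Rightarrow> real) \<Rightarrow> real \<Rightarrow> (real \<Rightarrow> real) \<Rightarrow> bool" where
  "MO_solution N f lam u \<longleftrightarrow>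
    (\<exists>u1 u2.
       (\<forall>r\<in>{0..1}. (u has_real_derivative u1 r) (at r within {0..1}) \<and>
                    (u1 has_real_derivative u2 r) (at r within {0..1})) \<and>
       continuous_on {0..1} u2 \<and>
       (\<forall>r\<in>{0<..<1}. ((\<lambda>s. (u1 s) ^ N) has_real_derivative
           lam ^ N * real N * r ^ (N - 1) * f (- u r)) (at r)) \<and>
       u1 0 = 0 \<and> u 1 = 0)"

definition eigen_solution :: "nat \<Rightarrow> real \<Rightarrow> (real \<Rightarrow> real) \<Rightarrow> bool" where
  "eigen_solution N lam v \<longleftrightarrow>
    (\<exists>v1 v2.
       (\<forall>r\<in>{0..1}. (v has_real_derivative v1 r) (at r within {0..1}) \<and>
                    (v1 has_real_derivative v2 r) (at r within {0..1})) \<and>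
       continuous_on {0..1} v2 \<and>
       (\<forall>r\<in>{0<..<1}. ((\<lambda>s. (- v1 s) ^ N) has_real_derivative
           lam ^ N * real N * r ^ (N - 1) * (v r) ^ N) (at r)) \<and>
       v1 0 = 0 \<and> v 1 = 0)"

definition first_eigenvalue :: "nat \<Rightarrow> real" where
  "first_eigenvalue N = (THE lam. lam > 0 \<and>
      (\<exists>v. eigen_solution N lam v \<and> (\<forall>r\<in>{0<..<1}. v r > 0)))"

end

theory Submission
  imports Defs "HOL-Complex_Analysis.Great_Picard"
begin

text \<open>Up to the signs of \<open>u\<close> and of the argument of \<open>f\<close>, both solutions are of the form
  \<open>u = \<plusminus>d * w\<close> where \<open>w\<close> is decreasing, \<open>w 0 = 1\<close>, \<open>w 1 = 0\<close> and \<open>w\<close> solves the initial value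
  problem \<open>- w' r = root N (\<integral>\<^sub>0\<^sup>r N s ^ (N - 1) g\<^sub>d (w s) ds)\<close> with
  \<open>g\<^sub>d s = lam ^ N * f (d * s) / d ^ N\<close>. As \<open>d\<close> tends to \<open>0\<close> or to infinity, \<open>g\<^sub>d\<close> tends to
  \<open>(lam * f0 * s) ^ N\<close> or \<open>(lam * finf * s) ^ N\<close>; for these limits a comparison with the first
  eigenfunction shows that \<open>w 1\<close> has opposite signs. Since \<open>f\<close> is merely continuous, the initial
  value problem need not be uniquely solvable; the intermediate value argument in \<open>d\<close> is therefore
  carried out for Tonelli's delayed approximations, and Arzela-Ascoli gives the solution in the limit.
  The same shooting argument yields the first eigenvalue itself.\<close>

section \<open>Radial integrals\<close>

text \<open>Integrating \<open>((- w')^N)' = N * r^(N-1) * k\<close> from the origin, where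
  \<open>w'\<close> vanishes, gives \<open>(- w')^N\<close>. Up to the volume of the unit ball, this
  is the integral of the radial function \<open>k\<close> over the ball of radius \<open>r\<close>
  in dimension \<open>N\<close>.\<close>

definition radial_mass :: "nat \<Rightarrow> (real \<Rightarrow> real) \<Rightarrow> real \<Rightarrow> real" where
  "radial_mass N k r = integral {0..r} (\<lambda>s. real N * s ^ (N - 1) * k s)"

definition radial_slope :: "nat \<Rightarrow> (real \<Rightarrow> real) \<Rightarrow> real \<Rightarrow> real" where
  "radial_slope N k r = root N (radial_mass N k r)"

section \<open>Calculus on an interval: mean values, monotonicity, convexity\<close>

lemma mvt_within:
  fixes f f' :: "real \<Rightarrow> real"
  assumes "a < b" and "{a..b} \<subseteq> S"
    and "\<And>x. x \<in> {a..b} \<Longrightarrow> (f has_real_derivative f' x) (at x within S)"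
  obtains z where "a < z" "z < b" "f b - f a = f' z * (b - a)"
proof -
  have "\<exists>x\<in>{a<..<b}. f b - f a = f' x * (b - a)"
    by (rule mvt_simple[OF assms(1), of f "\<lambda>x. (*) (f' x)"])
      (use assms(2,3) in \<open>auto simp flip: has_field_derivative_def intro: has_field_derivative_subset\<close>)
  then show ?thesis
    using that by auto
qed

lemma deriv_nonpos_imp_antimono_within:
  fixes f f' :: "real \<Rightarrow> real"
  assumes "a \<le> b" and "{a..b} \<subseteq> S"
    and der: "\<And>x. x \<in> {a..b} \<Longrightarrow> (f has_real_derivative f' x) (at x within S)"
    and neg: "\<And>x. x \<in> {a<..<b} \<Longrightarrow> f' x \<le> 0"
  shows "f b \<le> f a"
proof (cases "a = b")
  case False
  with \<open>a \<le> b\<close> have "a < b" by simp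
  obtain z where z: "a < z" "z < b" "f b - f a = f' z * (b - a)"
    using mvt_within[OF \<open>a < b\<close> assms(2) der] by blast
  then have "f' z * (b - a) \<le> 0"
    using neg[of z] \<open>a < b\<close> by (intro mult_nonpos_nonneg) auto
  then show ?thesis using z by linarith
qed simp

lemma deriv_neg_imp_less_within:
  fixes f f' :: "real \<Rightarrow> real"
  assumes "a < b" and "{a..b} \<subseteq> S"
    and der: "\<And>x. x \<in> {a..b} \<Longrightarrow> (f has_real_derivative f' x) (at x within S)"
    and neg: "\<And>x. x \<in> {a<..<b} \<Longrightarrow> f' x < 0"
  shows "f b < f a"
proof -
  obtain z where z: "a < z" "z < b" "f b - f a = f' z * (b - a)"
    using mvt_within[OF \<open>a < b\<close> assms(2) der] by blast
  then have "f' z * (b - a) < 0"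
    using neg[of z] \<open>a < b\<close> by (intro mult_neg_pos) auto
  then show ?thesis using z by linarith
qed

text \<open>The mean value theorem on \<open>[x, z]\<close> and \<open>[z, y]\<close> produces two
  slopes to compare; weighted with \<open>1 - t\<close> and \<open>t\<close>, both increments carry
  the same factor \<open>(1 - t) * t * (y - x)\<close>.\<close>

lemma strictly_convex_on_if_deriv_strict_mono:
  assumes der: "\<And>x. x \<in> {a<..<b} \<Longrightarrow> (g has_real_derivative g' x) (at x)"
    and mono: "strict_mono_on {a<..<b} g'"
  shows "strictly_convex_on {a<..<b} g"
proof -
  have key: "g ((1 - t) * x + t * y) < (1 - t) * g x + t * g y"
    if xy: "a < x" "x < y" "y < b" and t: "0 < t" "t < 1" for x y t
  proof -
    define z where "z = (1 - t) * x + t * y"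
    have zx: "z - x = t * (y - x)" and yz: "y - z = (1 - t) * (y - x)"
      by (simp_all add: z_def algebra_simps)
    have "x < z" "z < y"
      using xy t zx yz by (smt (verit) mult_pos_pos)+
    obtain p where p: "x < p" "p < z" "g z - g x = g' p * (z - x)"
      by (rule mvt_within[OF \<open>x < z\<close> subset_UNIV der]) (use xy \<open>z < y\<close> in auto)
    obtain q where q: "z < q" "q < y" "g y - g z = g' q * (y - z)"
      by (rule mvt_within[OF \<open>z < y\<close> subset_UNIV der]) (use xy \<open>x < z\<close> in auto)
    have "g' p < g' q"
      using strict_mono_onD[OF mono, of p q] p q xy by auto
    then have "(1 - t) * t * (y - x) * g' p < (1 - t) * t * (y - x) * g' q"
      using xy t by (intro mult_strict_left_mono) auto
    moreover have "(1 - t) * (g z - g x) = (1 - t) * t * (y - x) * g' p"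
      "t * (g y - g z) = (1 - t) * t * (y - x) * g' q"
      using p(3) q(3) zx yz by simp_all
    ultimately show ?thesis
      unfolding z_def[symmetric] by (simp add: algebra_simps)
  qed
  show ?thesis
    unfolding strictly_convex_on_def
  proof (intro conjI ballI allI impI)
    fix x y t :: real
    assume x: "x \<in> {a<..<b}" and y: "y \<in> {a<..<b}" and t: "x \<noteq> y \<and> 0 < t \<and> t < 1"
    show "g ((1 - t) * x + t * y) < (1 - t) * g x + t * g y"
    proof (cases "x < y")
      case True
      then show ?thesis using key[of x y t] x y t by auto
    next
      case False
      then show ?thesis using key[of y x "1 - t"] x y t by (auto simp: algebra_simps)
    qed
  qed simp
qed

section \<open>Integrals with a variable upper limit\<close>

lemma integral_atLeastAtMost_rescale:
  fixes f :: "real \<Rightarrow> real"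
  assumes "0 \<le> r"
  shows "integral {0..r} f = r * integral {0..1} (\<lambda>x. f (r * x))"
proof (cases "r = 0")
  case False
  with assms have "r > 0" by simp
  then have "(\<lambda>x. x / r) ` {0..r} = {0..1}"
    by (auto simp: image_iff divide_simps intro!: bexI[of _ "_ * r"])
  then show ?thesis
    using integral_stretch_real[of r 0 r f] \<open>r > 0\<close> by (simp add: field_simps)
qed simp

text \<open>Rescaling to \<open>{0..1}\<close> moves the variable endpoint into the integrand, so
  that continuity of parameter integrals over a fixed interval applies.\<close>

lemma continuous_on_integral_upto:
  fixes F :: "'a::topological_space \<Rightarrow> real \<Rightarrow> real"
  assumes "continuous_on (T \<times> {0..b}) (\<lambda>(t, s). F t s)"
  shows "continuous_on (T \<times> {0..b}) (\<lambda>(t, r). integral {0..r} (F t))"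
proof -
  have "continuous_on ((T \<times> {0..b}) \<times> cbox 0 1) (\<lambda>(p, x). F (fst p) (snd p * x))"
  proof -
    have "continuous_on ((T \<times> {0..b}) \<times> cbox 0 1)
        ((\<lambda>(t, s). F t s) \<circ> (\<lambda>(p, x). (fst p, snd p * x)))"
    proof (rule continuous_on_compose)
      show "continuous_on ((T \<times> {0..b}) \<times> cbox 0 1) (\<lambda>(p, x). (fst p, snd p * x :: real))"
        by (auto simp: case_prod_unfold intro!: continuous_intros)
      have "snd p * x \<le> b" if "0 \<le> snd p" "snd p \<le> b" "0 \<le> x" "x \<le> 1" for p :: "'a \<times> real" and x
        using that mult_left_le[of x "snd p"] by linarith
      then show "continuous_on ((\<lambda>(p, x). (fst p, snd p * x)) ` ((T \<times> {0..b}) \<times> cbox 0 1))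
          (\<lambda>(t, s). F t s)"
        by (intro continuous_on_subset[OF assms]) auto
    qed
    then show ?thesis by (simp add: o_def case_prod_unfold)
  qed
  from integral_continuous_on_param[OF this]
  have "continuous_on (T \<times> {0..b}) (\<lambda>p. snd p * integral {0..1} (\<lambda>x. F (fst p) (snd p * x)))"
    by (auto intro!: continuous_intros)
  then show ?thesis
    by (rule continuous_on_eq) (auto simp: integral_atLeastAtMost_rescale[symmetric])
qed

lemma continuous_on_radial_integrand:
  "continuous_on S k \<Longrightarrow> continuous_on S (\<lambda>s. real N * s ^ (N - 1) * k s)"
  by (intro continuous_intros)

section \<open>Elementary properties of mass and slope\<close>

lemma radial_mass_0 [simp]: "radial_mass N k 0 = 0"
  by (simp add: radial_mass_def)

lemma radial_slope_0 [simp]: "radial_slope N k 0 = 0"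
  by (simp add: radial_slope_def)

lemma radial_mass_has_derivative:
  assumes "continuous_on {0..b} k" "r \<in> {0..b}"
  shows "(radial_mass N k has_real_derivative real N * r ^ (N - 1) * k r) (at r within {0..b})"
  unfolding radial_mass_def
  by (rule integral_has_real_derivative[OF continuous_on_radial_integrand]) (use assms in auto)

lemma continuous_on_radial_mass:
  "continuous_on {0..b} k \<Longrightarrow> continuous_on {0..b} (radial_mass N k)"
  by (rule DERIV_continuous_on) (rule radial_mass_has_derivative)

lemma continuous_on_radial_slope:
  "continuous_on {0..b} k \<Longrightarrow> continuous_on {0..b} (radial_slope N k)"
  unfolding radial_slope_def by (intro continuous_intros continuous_on_radial_mass)

lemma radial_mass_cong:
  "(\<And>s. s \<in> {0..r} \<Longrightarrow> k s = l s) \<Longrightarrow> radial_mass N k r = radial_mass N l r"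
  unfolding radial_mass_def by (intro integral_cong) auto

lemma radial_slope_cong:
  "(\<And>s. s \<in> {0..r} \<Longrightarrow> k s = l s) \<Longrightarrow> radial_slope N k r = radial_slope N l r"
  unfolding radial_slope_def by (subst radial_mass_cong[of r k l]) auto

lemma radial_mass_cmult: "radial_mass N (\<lambda>s. c * k s) r = c * radial_mass N k r"
proof -
  have "(\<lambda>s. real N * s ^ (N - 1) * (c * k s)) = (\<lambda>s. c * (real N * s ^ (N - 1) * k s))"
    by (simp add: algebra_simps)
  then show ?thesis by (simp add: radial_mass_def)
qed

text \<open>The homogeneity behind all rescalings: an amplitude or eigenvalue factor passes through
  the \<open>N\<close>-th root.\<close>

lemma radial_slope_cmult:
  "N \<ge> 1 \<Longrightarrow> 0 \<le> c \<Longrightarrow> radial_slope N (\<lambda>s. c ^ N * k s) r = c * radial_slope N k r"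
  by (simp add: radial_slope_def radial_mass_cmult real_root_mult real_root_power_cancel)

lemma radial_integrand_integrable:
  "continuous_on {0..b} k \<Longrightarrow> r \<le> b \<Longrightarrow> (\<lambda>s. real N * s ^ (N - 1) * k s) integrable_on {0..r}"
  by (rule integrable_continuous_real, rule continuous_on_radial_integrand)
    (auto elim: continuous_on_subset)

lemma radial_mass_mono:
  assumes "continuous_on {0..b} k" "continuous_on {0..b} l" "r \<le> b"
    and "\<And>s. s \<in> {0..r} \<Longrightarrow> k s \<le> l s"
  shows "radial_mass N k r \<le> radial_mass N l r"
  unfolding radial_mass_def
  by (rule integral_le[OF radial_integrand_integrable[OF assms(1,3)] radial_integrand_integrable[OF assms(2,3)]])
    (use assms in \<open>auto intro!: mult_left_mono\<close>)

lemma radial_slope_mono: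
  assumes "N \<ge> 1" "continuous_on {0..b} k" "continuous_on {0..b} l" "r \<le> b"
    and "\<And>s. s \<in> {0..r} \<Longrightarrow> k s \<le> l s"
  shows "radial_slope N k r \<le> radial_slope N l r"
  unfolding radial_slope_def using radial_mass_mono[OF assms(2-)] assms(1) by simp

lemma radial_mass_nonneg:
  assumes "continuous_on {0..b} k" "r \<le> b" "\<And>s. s \<in> {0..r} \<Longrightarrow> 0 \<le> k s"
  shows "0 \<le> radial_mass N k r"
  using radial_mass_mono[of b "\<lambda>_. 0" k r N] assms by (auto simp: radial_mass_def)

lemma radial_mass_mono_radius:
  assumes "continuous_on {0..b} k" "0 \<le> x" "x \<le> y" "y \<le> b" "\<And>s. s \<in> {0..y} \<Longrightarrow> 0 \<le> k s"
  shows "radial_mass N k x \<le> radial_mass N k y"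
  unfolding radial_mass_def
  by (rule integral_subset_le[OF _ radial_integrand_integrable[OF assms(1)]
        radial_integrand_integrable[OF assms(1)]]) (use assms in auto)

lemma radial_slope_mono_radius:
  assumes "N \<ge> 1" "continuous_on {0..b} k" "0 \<le> x" "x \<le> y" "y \<le> b" "\<And>s. s \<in> {0..y} \<Longrightarrow> 0 \<le> k s"
  shows "radial_slope N k x \<le> radial_slope N k y"
  unfolding radial_slope_def using radial_mass_mono_radius[OF assms(2-)] assms(1) by simp

lemma radial_slope_nonneg:
  assumes "N \<ge> 1" "continuous_on {0..b} k" "r \<le> b" "\<And>s. s \<in> {0..r} \<Longrightarrow> 0 \<le> k s"
  shows "0 \<le> radial_slope N k r"
  unfolding radial_slope_def using radial_mass_nonneg[OF assms(2-), of N] assms(1) by simp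

lemma radial_mass_const:
  assumes "N \<ge> 1" "0 \<le> r"
  shows "radial_mass N (\<lambda>_. c) r = c * r ^ N"
proof -
  have "((\<lambda>s. real N * s ^ (N - 1) * c) has_integral c * r ^ N - c * 0 ^ N) {0..r}"
    by (rule fundamental_theorem_of_calculus[OF \<open>0 \<le> r\<close>])
      (auto intro!: derivative_eq_intros simp flip: has_real_derivative_iff_has_vector_derivative)
  from integral_unique[OF this] show ?thesis
    using assms(1) unfolding radial_mass_def by simp
qed

text \<open>By continuity \<open>k\<close> stays above \<open>k 0 / 2\<close> on some
  \<open>[0, e]\<close>, which alone contributes at least \<open>k 0 / 2 * e ^ N\<close>. Further
  out \<open>k\<close> may vanish, as truncated nonlinearities do.\<close>

lemma radial_mass_pos:
  assumes "N \<ge> 1" "continuous_on {0..b} k" "0 < r" "r \<le> b"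
    and "\<And>s. s \<in> {0..r} \<Longrightarrow> 0 \<le> k s" and "0 < k 0"
  shows "0 < radial_mass N k r"
proof -
  have "continuous (at 0 within {0..b}) k"
    using assms by (auto simp: continuous_on_eq_continuous_within)
  then have "eventually (\<lambda>x. k x > k 0 / 2) (at 0 within {0..b})"
    using assms(6) unfolding continuous_within by (intro order_tendstoD(1)) auto
  then obtain d where d: "d > 0" "\<And>x. x \<in> {0..b} \<Longrightarrow> x \<noteq> 0 \<Longrightarrow> dist x 0 < d \<Longrightarrow> k x > k 0 / 2"
    unfolding eventually_at by auto
  define e where "e = min (d / 2) r"
  have e: "0 < e" "e \<le> r" "e < d" using d assms by (auto simp: e_def)
  have "0 < k 0 / 2 * e ^ N" using assms(6) e by simp
  also have "\<dots> = radial_mass N (\<lambda>_. k 0 / 2) e"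
    using radial_mass_const[OF assms(1), of e "k 0 / 2"] e by simp
  also have "\<dots> \<le> radial_mass N k e"
  proof (rule radial_mass_mono[of b])
    fix s assume s: "s \<in> {0..e}"
    show "k 0 / 2 \<le> k s"
      using s e d(2)[of s] assms by (cases "s = 0") auto
  qed (use assms e in auto)
  also have "\<dots> \<le> radial_mass N k r"
    by (rule radial_mass_mono_radius[of b]) (use assms e in auto)
  finally show ?thesis .
qed

lemma radial_slope_pos:
  assumes "N \<ge> 1" "continuous_on {0..b} k" "0 < r" "r \<le> b"
    and "\<And>s. s \<in> {0..r} \<Longrightarrow> 0 \<le> k s" and "0 < k 0"
  shows "0 < radial_slope N k r"
  unfolding radial_slope_def using radial_mass_pos[OF assms] assms(1) by simp

lemma radial_slope_power:
  assumes "N \<ge> 1" "continuous_on {0..b} k" "r \<le> b" "\<And>s. s \<in> {0..r} \<Longrightarrow> 0 \<le> k s"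
  shows "radial_slope N k r ^ N = radial_mass N k r"
  unfolding radial_slope_def using radial_mass_nonneg[OF assms(2-), of N] assms(1) by simp

text \<open>The source of strict convexity: off the origin the mass has positive derivative, and
  \<open>root N\<close> is strictly increasing.\<close>

lemma radial_slope_strict_mono:
  assumes N: "N \<ge> 1" and k: "continuous_on {0..b} k" and pos: "\<And>s. s \<in> {0..<b} \<Longrightarrow> 0 < k s"
  shows "strict_mono_on {0<..<b} (radial_slope N k)"
proof (rule strict_mono_onI)
  fix x y assume xy: "x \<in> {0<..<b}" "y \<in> {0<..<b}" "x < y"
  obtain z where z: "x < z" "z < y"
    "radial_mass N k y - radial_mass N k x = real N * z ^ (N - 1) * k z * (y - x)"
    by (rule mvt_within[OF \<open>x < y\<close>, where S = "{0..b}" and f = "radial_mass N k"])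
      (use xy k in \<open>auto intro!: radial_mass_has_derivative\<close>)
  have "0 < real N * z ^ (N - 1) * k z * (y - x)"
    using N xy z pos[of z] by (intro mult_pos_pos) auto
  then show "radial_slope N k x < radial_slope N k y"
    using z(3) N by (simp add: radial_slope_def)
qed

text \<open>Writing the mass as \<open>r ^ N\<close> times a mean value \<open>\<kappa> r\<close> of \<open>k\<close> over the ball of radius \<open>r\<close>
  gives the slope as \<open>r * root N (\<kappa> r)\<close>, which shows that the origin is not singular.\<close>

lemma radial_slope_C1:
  assumes N: "N \<ge> 1" and k: "continuous_on {0..1} k" and pos: "\<And>s. s \<in> {0..<1} \<Longrightarrow> 0 < k s"
  obtains q where "continuous_on {0..1} q"
    "\<And>r. r \<in> {0..1} \<Longrightarrow> (radial_slope N k has_real_derivative q r) (at r within {0..1})"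
proof -
  define \<kappa> where "\<kappa> r = integral {0..1} (\<lambda>x. real N * x ^ (N - 1) * k (r * x))" for r
  \<comment> \<open>For \<open>r > 0\<close> the chain rule gives
    \<open>r ^ (N - 1) * k r / root N (r ^ N * \<kappa> r) ^ (N - 1)\<close>. The powers of
    \<open>r\<close> cancel, and what remains is continuous up to the origin.\<close>
  define q where "q r = root N (\<kappa> r) / \<kappa> r * k r" for r
  have mass: "radial_mass N k r = r ^ N * \<kappa> r" if "0 \<le> r" for r
  proof -
    have "radial_mass N k r = r * integral {0..1} (\<lambda>x. real N * (r * x) ^ (N - 1) * k (r * x))"
      unfolding radial_mass_def by (rule integral_atLeastAtMost_rescale[OF that])
    also have "(\<lambda>x. real N * (r * x) ^ (N - 1) * k (r * x))
        = (\<lambda>x. r ^ (N - 1) * (real N * x ^ (N - 1) * k (r * x)))"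
      by (simp add: power_mult_distrib algebra_simps)
    finally show ?thesis
      using N by (cases N) (simp_all add: \<kappa>_def)
  qed
  \<comment> \<open>Since \<open>k\<close> may vanish at \<open>1\<close>, the sign there is
    obtained as a limit from the interior.\<close>
  have nonneg: "0 \<le> k s" if "s \<in> {0..1}" for s
    by (rule continuous_ge_on_closure[of "{0<..<1}" k]) (use k pos that in \<open>auto simp: less_imp_le\<close>)
  \<comment> \<open>The weight \<open>N * x ^ (N - 1)\<close> has integral 1 over
    \<open>[0, 1]\<close>.\<close>
  have k0: "\<kappa> 0 = k 0"
    using radial_mass_const[OF N, of 1 "k 0"] by (simp add: \<kappa>_def radial_mass_def)
  have \<kappa>_pos: "0 < \<kappa> r" if "r \<in> {0..1}" for r
  proof (cases "r = 0")
    case True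
    then show ?thesis using k0 pos[of 0] by simp
  next
    case False
    then have "0 < radial_mass N k r"
      using that nonneg pos[of 0] by (intro radial_mass_pos[OF N k]) auto
    then show ?thesis using mass[of r] that False by (simp add: zero_less_mult_iff)
  qed
  have \<kappa>_cont: "continuous_on {0..1} \<kappa>"
  proof -
    have "continuous_on ({0..1} \<times> {0..1}) (k \<circ> (\<lambda>(r, x). r * x))"
      by (rule continuous_on_compose)
        (auto simp: case_prod_unfold intro!: continuous_intros continuous_on_subset[OF k] mult_le_one)
    then have "continuous_on ({0..1} \<times> cbox 0 1) (\<lambda>(r, x). real N * x ^ (N - 1) * k (r * x))"
      by (auto simp: case_prod_unfold o_def intro!: continuous_intros)
    from integral_continuous_on_param[OF this] show ?thesis
      by (simp add: \<kappa>_def[abs_def])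
  qed
  have q_cont: "continuous_on {0..1} q"
    unfolding q_def using \<kappa>_pos by (intro continuous_intros \<kappa>_cont k) force
  have slope: "radial_slope N k r = r * root N (\<kappa> r)" if "0 \<le> r" for r
    using N that mass[OF that] by (simp add: radial_slope_def real_root_mult real_root_power_cancel)
  have "(radial_slope N k has_real_derivative q r) (at r within {0..1})" if r: "r \<in> {0..1}" for r
  proof (cases "r = 0")
    case True
    have "((\<lambda>y. root N (\<kappa> y)) \<longlongrightarrow> root N (\<kappa> 0)) (at 0 within {0..1})"
      using \<kappa>_cont by (intro tendsto_intros) (auto simp: continuous_on_def)
    then have "((\<lambda>y. (radial_slope N k y - radial_slope N k 0) / (y - 0)) \<longlongrightarrow> root N (\<kappa> 0))
        (at 0 within {0..1})"
      by (rule tendsto_cong[THEN iffD1, rotated])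
        (auto simp: eventually_at slope intro!: exI[of _ 1])
    moreover have "q 0 = root N (\<kappa> 0)"
      using \<kappa>_pos[of 0] k0 by (simp add: q_def)
    ultimately show ?thesis
      using True by (simp add: has_field_derivative_iff)
  next
    case False
    with r have "0 < r" by simp
    have m: "0 < radial_mass N k r"
      using mass[of r] \<kappa>_pos[OF r] \<open>0 < r\<close> by simp
    have "(radial_slope N k has_real_derivative
        inverse (real N * root N (radial_mass N k r) ^ (N - Suc 0)) * (real N * r ^ (N - 1) * k r))
        (at r within {0..1})"
      unfolding radial_slope_def[abs_def]
      by (rule DERIV_chain2[OF DERIV_real_root radial_mass_has_derivative[OF k r]])
        (use N m in auto)
    moreover have "inverse (real N * root N (radial_mass N k r) ^ (N - Suc 0)) * (real N * r ^ (N - 1) * k r) = q r"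
    proof -
      have pw: "root N (\<kappa> r) ^ N = \<kappa> r" "root N (\<kappa> r) > 0"
        using N \<kappa>_pos[OF r] by auto
      have "root N (\<kappa> r) ^ N = root N (\<kappa> r) * root N (\<kappa> r) ^ (N - 1)"
        using N by (cases N) simp_all
      then have "inverse (root N (\<kappa> r) ^ (N - 1)) = root N (\<kappa> r) / \<kappa> r"
        using pw \<kappa>_pos[OF r] by (simp add: field_simps)
      moreover have "root N (radial_mass N k r) = r * root N (\<kappa> r)"
        using slope[of r] \<open>0 < r\<close> by (simp add: radial_slope_def)
      ultimately show ?thesis
        using N \<open>0 < r\<close>
        by (simp add: q_def power_mult_distrib del: inverse_eq_divide, simp add: field_simps)
    qed
    ultimately show ?thesis by simp
  qed
  with q_cont that show ?thesis by blast
qed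

section \<open>Comparison of eigenfunctions\<close>

text \<open>If \<open>\<tau> * v \<le> w\<close>, then integrating the equations inwards from \<open>R\<close> gives
  \<open>(c / \<mu>) * \<tau> * v \<le> w\<close>. For \<open>c > \<mu>\<close> this could be iterated for ever.\<close>

lemma radial_eigen_comparison:
  assumes N: "N \<ge> 1" and R: "0 < R" and \<mu>: "0 < \<mu>"
    and v_der: "\<And>r. r \<in> {0..R} \<Longrightarrow>
      (v has_real_derivative - (\<mu> * radial_slope N (\<lambda>s. v s ^ N) r)) (at r within {0..R})"
    and w_der: "\<And>r. r \<in> {0..R} \<Longrightarrow>
      (w has_real_derivative - (c * radial_slope N (\<lambda>s. w s ^ N) r)) (at r within {0..R})"
    and v_pos: "\<And>r. r \<in> {0..<R} \<Longrightarrow> 0 < v r"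
    and w_pos: "\<And>r. r \<in> {0..<R} \<Longrightarrow> 0 < w r"
    and vR: "v R = 0" and wR: "0 \<le> w R"
  shows "c \<le> \<mu>"
proof (rule ccontr)
  assume "\<not> c \<le> \<mu>"
  then have c: "0 < c" "\<mu> < c" using \<mu> by auto
  define q where "q = c / \<mu>"
  have q: "1 < q" "q * \<mu> = c" using c \<mu> by (auto simp: q_def)
  let ?V = "radial_slope N (\<lambda>s. v s ^ N)" and ?W = "radial_slope N (\<lambda>s. w s ^ N)"
  have vc: "continuous_on {0..R} v" and wc: "continuous_on {0..R} w"
    by (auto intro!: DERIV_continuous_on v_der w_der)
  have vc': "continuous_on {0..R} (\<lambda>s. v s ^ N)" and wc': "continuous_on {0..R} (\<lambda>s. w s ^ N)"
    using vc wc by (auto intro!: continuous_intros)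
  have v0: "0 \<le> v r" and w0: "0 \<le> w r" if "r \<in> {0..R}" for r
    using v_pos[of r] w_pos[of r] vR wR that by (cases "r = R"; force)+
  have diff: "((\<lambda>r. w r - \<sigma> * v r) has_real_derivative \<sigma> * \<mu> * ?V r - c * ?W r) (at r within {0..R})"
    if "r \<in> {0..R}" for r \<sigma>
    by (rule derivative_eq_intros v_der[OF that] w_der[OF that] refl)+ simp
  have step: "q * \<tau> * v r \<le> w r"
    if \<tau>: "0 \<le> \<tau>" "\<And>r. r \<in> {0..R} \<Longrightarrow> \<tau> * v r \<le> w r" and r: "r \<in> {0..R}" for \<tau> r
  proof -
    \<comment> \<open>The difference \<open>w - q * \<tau> * v\<close> is nonincreasing, because
      \<open>\<tau> * ?V \<le> ?W\<close> and \<open>q * \<mu> = c\<close>; at \<open>R\<close> it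
      is nonnegative.\<close>
    have "w R - q * \<tau> * v R \<le> w r - q * \<tau> * v r"
    proof (rule deriv_nonpos_imp_antimono_within[where S = "{0..R}", OF _ _ diff])
      fix x assume x: "x \<in> {r<..<R}"
      have "\<tau> * ?V x = radial_slope N (\<lambda>s. \<tau> ^ N * v s ^ N) x"
        using radial_slope_cmult[OF N \<tau>(1)] by simp
      also have "\<dots> \<le> ?W x"
      proof (rule radial_slope_mono[OF N _ wc'])
        show "continuous_on {0..R} (\<lambda>s. \<tau> ^ N * v s ^ N)"
          by (intro continuous_intros vc)
        fix s assume "s \<in> {0..x}"
        then have "s \<in> {0..R}" using x by auto
        then show "\<tau> ^ N * v s ^ N \<le> w s ^ N"
          unfolding power_mult_distrib[symmetric] using \<tau> v0 by (intro power_mono) auto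
      qed (use x in auto)
      finally have "c * (\<tau> * ?V x) \<le> c * ?W x" using c by simp
      moreover have "q * \<tau> * \<mu> * ?V x = c * (\<tau> * ?V x)"
        unfolding q(2)[symmetric] by simp
      ultimately show "q * \<tau> * \<mu> * ?V x - c * ?W x \<le> 0" by linarith
    qed (use r in auto)
    then show ?thesis using vR wR by simp
  qed
  \<comment> \<open>Both functions may vanish at \<open>R\<close>, so on \<open>[R / 2, R]\<close>
    the slopes are compared: \<open>b\<close> bounds that of \<open>v\<close> from above and
    \<open>a\<close> that of \<open>w\<close> from below. On \<open>[0, R / 2]\<close> the values
    are compared, with \<open>v 0\<close> above \<open>v\<close> and \<open>w (R / 2)\<close> below
    \<open>w\<close>.\<close>
  obtain \<tau> where \<tau>: "0 < \<tau>" "\<And>r. r \<in> {0..R} \<Longrightarrow> \<tau> * v r \<le> w r"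
  proof -
    define a where "a = c * ?W (R / 2)"
    define b where "b = \<mu> * ?V R"
    have "0 < ?W (R / 2)"
      using R w_pos[of 0] w0 N by (intro radial_slope_pos[OF N wc']) auto
    then have a: "0 < a" using c by (simp add: a_def)
    have "0 < ?V R"
      using R v_pos[of 0] v0 N by (intro radial_slope_pos[OF N vc']) auto
    then have b: "0 < b" using \<mu> by (simp add: b_def)
    define \<tau> where "\<tau> = min (a / b) (w (R / 2) / v 0)"
    have wh: "0 < w (R / 2)" and v00: "0 < v 0" using w_pos v_pos R by auto
    have \<tau>: "0 < \<tau>" "\<tau> * b \<le> a" "\<tau> * v 0 \<le> w (R / 2)"
      using a b wh v00 by (auto simp: \<tau>_def min_def field_simps)
    have V_nonneg: "0 \<le> ?V x" and W_nonneg: "0 \<le> ?W x" if "x \<in> {0..R}" for x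
      using that v0 w0 by (auto intro!: radial_slope_nonneg[OF N vc'] radial_slope_nonneg[OF N wc'])
    have "\<tau> * v r \<le> w r" if r: "r \<in> {0..R}" for r
    proof (cases "R / 2 \<le> r")
      case True
      have "w R - \<tau> * v R \<le> w r - \<tau> * v r"
      proof (rule deriv_nonpos_imp_antimono_within[where S = "{0..R}", OF _ _ diff])
        fix x assume x: "x \<in> {r<..<R}"
        have "\<tau> * \<mu> * ?V x \<le> \<tau> * \<mu> * ?V R"
          using x r \<tau> \<mu> v0
          by (intro mult_left_mono radial_slope_mono_radius[OF N vc']) auto
        moreover have "c * ?W (R / 2) \<le> c * ?W x"
          using x r c w0 R True by (intro mult_left_mono radial_slope_mono_radius[OF N wc']) auto
        ultimately show "\<tau> * \<mu> * ?V x - c * ?W x \<le> 0"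
          using \<tau>(2) by (simp add: a_def b_def mult.assoc)
      qed (use r in auto)
      then show ?thesis using vR wR by simp
    next
      case False
      have "v r \<le> v 0"
        by (rule deriv_nonpos_imp_antimono_within[where S = "{0..R}", OF _ _ v_der])
          (use r \<mu> V_nonneg in auto)
      then have "\<tau> * v r \<le> \<tau> * v 0" using \<tau> by simp
      also have "\<dots> \<le> w (R / 2)" by fact
      also have "\<dots> \<le> w r"
        by (rule deriv_nonpos_imp_antimono_within[where S = "{0..R}", OF _ _ w_der])
          (use False r R c W_nonneg in auto)
      finally show ?thesis .
    qed
    with \<tau>(1) that show ?thesis by blast
  qed
  have iter: "q ^ n * \<tau> * v r \<le> w r" if "r \<in> {0..R}" for n r
    using that
  proof (induction n arbitrary: r)
    case 0
    then show ?case using \<tau>(2) by simp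
  next
    case (Suc n)
    have "q * (q ^ n * \<tau>) * v r \<le> w r"
      using \<tau>(1) q(1) Suc by (intro step) auto
    then show ?case by (simp add: mult.assoc)
  qed
  \<comment> \<open>At the origin the iterated bound would keep \<open>q ^ n\<close> below a fixed
    number for all \<open>n\<close>.\<close>
  have "0 < \<tau> * v 0" using \<tau>(1) v_pos[of 0] R by simp
  moreover obtain n where "w 0 / (\<tau> * v 0) < q ^ n"
    using real_arch_pow[OF q(1)] by blast
  ultimately show False
    using iter[of 0 n] R by (simp add: field_simps)
qed

text \<open>The equation determines only the power \<open>(- v1 r) ^ N\<close>, which for even
  \<open>N\<close> leaves the sign of \<open>v1\<close> open. Since the mass is positive,
  \<open>v1\<close> has no zero in \<open>(0, 1]\<close>; it is negative somewhere, because
  \<open>v\<close> falls from \<open>v (1 / 2) > 0\<close> to \<open>v 1 = 0\<close>. By the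
  intermediate value theorem it is never positive, and the \<open>N\<close>-th root can be
  taken.\<close>

lemma eigen_solution_deriv:
  assumes N: "N \<ge> 1" and lam: "0 < lam" and sol: "eigen_solution N lam v"
    and pos: "\<forall>r\<in>{0<..<1}. 0 < v r"
  shows "v 1 = 0" and "\<And>r. r \<in> {0..<1} \<Longrightarrow> 0 < v r"
    and "\<And>r. r \<in> {0..1} \<Longrightarrow>
      (v has_real_derivative - (lam * radial_slope N (\<lambda>s. v s ^ N) r)) (at r within {0..1})"
proof -
  obtain v1 v2 where
    d1: "\<And>r. r \<in> {0..1} \<Longrightarrow> (v has_real_derivative v1 r) (at r within {0..1})" and
    d2: "\<And>r. r \<in> {0..1} \<Longrightarrow> (v1 has_real_derivative v2 r) (at r within {0..1})" and
    ode: "\<And>r. r \<in> {0<..<1} \<Longrightarrow> ((\<lambda>s. (- v1 s) ^ N) has_real_derivative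
        lam ^ N * real N * r ^ (N - 1) * v r ^ N) (at r)" and
    v10: "v1 0 = 0" and v1: "v 1 = 0"
    using sol unfolding eigen_solution_def by blast
  show "v 1 = 0" by fact
  have vc: "continuous_on {0..1} v" and v1c: "continuous_on {0..1} v1"
    by (auto intro!: DERIV_continuous_on d1 d2)
  let ?k = "\<lambda>s. lam ^ N * v s ^ N"
  have kc: "continuous_on {0..1} ?k" by (intro continuous_intros vc)
  have mass: "(- v1 r) ^ N = radial_mass N ?k r" if r: "r \<in> {0..1}" for r
  proof -
    have "((\<lambda>s. lam ^ N * real N * s ^ (N - 1) * v s ^ N) has_integral
        (- v1 r) ^ N - (- v1 0) ^ N) {0..r}"
      using r ode
      by (intro fundamental_theorem_of_calculus_interior)
        (auto intro!: continuous_intros continuous_on_subset[OF v1c]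
          simp flip: has_real_derivative_iff_has_vector_derivative)
    moreover have "(\<lambda>s. lam ^ N * real N * s ^ (N - 1) * v s ^ N)
        = (\<lambda>s. real N * s ^ (N - 1) * (lam ^ N * v s ^ N))"
      by (simp add: algebra_simps)
    ultimately show ?thesis
      using v10 N by (simp add: radial_mass_def integral_unique power_0_left)
  qed
  have nonneg: "0 \<le> v s" if "s \<in> {0..1}" for s
    by (rule continuous_ge_on_closure[of "{0<..<1}" v])
      (use vc pos that in \<open>auto simp: less_imp_le\<close>)
  have mass_pos: "0 < radial_mass N ?k r" if r: "0 < r" "r \<le> 1" for r
  proof -
    \<comment> \<open>Positivity of \<open>v 0\<close> is not yet known, so
      \<open>radial_mass_pos\<close> does not apply; the growth of the mass between
      \<open>r / 2\<close> and \<open>r\<close> is used instead.\<close>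
    have "radial_mass N ?k (r / 2) < radial_mass N ?k r"
    proof (rule ccontr)
      assume *: "\<not> ?thesis"
      obtain z where z: "r / 2 < z" "z < r"
        "radial_mass N ?k r - radial_mass N ?k (r / 2) = real N * z ^ (N - 1) * ?k z * (r - r / 2)"
        by (rule mvt_within[of "r / 2" r "{0..1}" "radial_mass N ?k"])
          (use r kc in \<open>auto intro!: radial_mass_has_derivative\<close>)
      have "0 < real N * z ^ (N - 1) * ?k z * (r - r / 2)"
        using N z r lam pos by (intro mult_pos_pos zero_less_power) auto
      then show False using * z(3) by simp
    qed
    moreover have "0 \<le> radial_mass N ?k (r / 2)"
      by (rule radial_mass_nonneg[OF kc]) (use nonneg lam r in auto)
    ultimately show ?thesis by simp
  qed
  have nz: "v1 r \<noteq> 0" if "0 < r" "r \<le> 1" for r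
    using mass[of r] mass_pos[OF that] that N by (auto simp: power_0_left)
  obtain z where z: "1 / 2 < z" "z < 1" "v 1 - v (1 / 2) = v1 z * (1 - 1 / 2)"
    by (rule mvt_within[of "1 / 2" 1 "{0..1}" v v1]) (use d1 in auto)
  have "v1 z < 0"
    using z(3) v1 pos[rule_format, of "1 / 2"] by auto
  have v1_nonpos: "v1 r \<le> 0" if r: "r \<in> {0..1}" for r
  proof (rule ccontr)
    assume "\<not> v1 r \<le> 0"
    then have "0 < v1 r" "r \<noteq> 0" using v10 by auto
    have "\<exists>x\<in>closed_segment r z. v1 x = 0"
    proof (cases "r \<le> z")
      case True
      have "\<exists>x\<ge>r. x \<le> z \<and> v1 x = 0"
        using \<open>0 < v1 r\<close> \<open>v1 z < 0\<close> True z r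
        by (intro IVT2') (auto intro: continuous_on_subset[OF v1c])
      then show ?thesis using True by (auto simp: closed_segment_eq_real_ivl)
    next
      case False
      have "\<exists>x\<ge>z. x \<le> r \<and> v1 x = 0"
        using \<open>0 < v1 r\<close> \<open>v1 z < 0\<close> False z r
        by (intro IVT') (auto intro: continuous_on_subset[OF v1c])
      then show ?thesis using False by (auto simp: closed_segment_eq_real_ivl)
    qed
    then show False
      using nz r z \<open>r \<noteq> 0\<close> by (auto simp: closed_segment_eq_real_ivl split: if_splits)
  qed
  have eq: "v1 r = - (lam * radial_slope N (\<lambda>s. v s ^ N) r)" if "r \<in> {0..1}" for r
  proof -
    have "root N ((- v1 r) ^ N) = - v1 r"
      using v1_nonpos[OF that] N by (intro real_root_power_cancel) auto
    then have "- v1 r = radial_slope N ?k r"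
      unfolding mass[OF that] radial_slope_def by simp
    then show ?thesis
      using radial_slope_cmult[OF N, of lam] lam by simp
  qed
  show "(v has_real_derivative - (lam * radial_slope N (\<lambda>s. v s ^ N) r)) (at r within {0..1})"
    if "r \<in> {0..1}" for r
    using d1[OF that] eq[OF that] by simp
  \<comment> \<open>Positivity extends to the origin because \<open>v\<close> is
    nonincreasing.\<close>
  have "v (1 / 2) \<le> v 0"
    by (rule deriv_nonpos_imp_antimono_within[where S = "{0..1}", OF _ _ d1])
      (use v1_nonpos in auto)
  then show "0 < v r" if "r \<in> {0..<1}" for r
    using that pos[rule_format, of r] pos[rule_format, of "1 / 2"] by (cases "r = 0") auto
qed

text \<open>Two positive eigenfunctions can be compared in both directions by
  \<open>radial_eigen_comparison\<close>, so each eigenvalue bounds the other; this gives the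
  uniqueness behind \<open>THE\<close>.\<close>

lemma first_eigenvalue_eqI:
  assumes N: "N \<ge> 1" and lam: "0 < lam" and sol: "eigen_solution N lam v"
    and pos: "\<forall>r\<in>{0<..<1}. 0 < v r"
  shows "first_eigenvalue N = lam"
  unfolding first_eigenvalue_def
proof (rule the_equality)
  show "lam > 0 \<and> (\<exists>v. eigen_solution N lam v \<and> (\<forall>r\<in>{0<..<1}. v r > 0))"
    using assms by blast
next
  fix \<mu> assume "\<mu> > 0 \<and> (\<exists>v. eigen_solution N \<mu> v \<and> (\<forall>r\<in>{0<..<1}. v r > 0))"
  then obtain w where \<mu>: "0 < \<mu>" and w: "eigen_solution N \<mu> w" "\<forall>r\<in>{0<..<1}. w r > 0"
    by blast
  note V = eigen_solution_deriv[OF N lam sol pos]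
  note W = eigen_solution_deriv[OF N \<mu> w]
  have "lam \<le> \<mu>"
    by (rule radial_eigen_comparison[OF N zero_less_one \<mu> W(3) V(3) W(2) V(2) W(1)]) (use V(1) in auto)
  moreover have "\<mu> \<le> lam"
    by (rule radial_eigen_comparison[OF N zero_less_one lam V(3) W(3) V(2) W(2) V(1)]) (use W(1) in auto)
  ultimately show "\<mu> = lam" by simp
qed

section \<open>Shooting for a family of initial value problems\<close>

text \<open>The integral form is the one that survives passage to a limit. The condition
  \<open>w 1 = 0\<close> is left out, being the target of the shooting.\<close>

definition radial_ivp :: "nat \<Rightarrow> (real \<Rightarrow> real) \<Rightarrow> (real \<Rightarrow> real) \<Rightarrow> bool" where
  "radial_ivp N g w \<longleftrightarrow> continuous_on {0..1} w \<and>
    (\<forall>r\<in>{0..1}. w r = 1 - integral {0..r} (radial_slope N (\<lambda>s. g (w s))))"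

text \<open>Truncation to 0 at negative arguments lets a solution cross zero and continue up to
  \<open>r = 1\<close>, so that the sign of \<open>w 1\<close> can serve as the shooting
  criterion.\<close>

locale radial_family =
  fixes N :: nat and G :: "real \<Rightarrow> real \<Rightarrow> real"
  assumes N: "N \<ge> 1"
    and cont: "continuous_on ({0..1} \<times> UNIV) (\<lambda>(t, s). G t s)"
    and nonneg: "t \<in> {0..1} \<Longrightarrow> 0 \<le> G t s"
    and zero: "t \<in> {0..1} \<Longrightarrow> s \<le> 0 \<Longrightarrow> G t s = 0"
begin

text \<open>Tonelli approximations: solutions of the initial value problem with a delay \<open>e\<close>, built up
  on successive intervals of length \<open>e\<close>. Unlike the solutions themselves, they are unique and
  depend continuously on the parameter \<open>t\<close>.\<close>

primrec delayed :: "nat \<Rightarrow> real \<Rightarrow> real \<Rightarrow> real \<Rightarrow> real" where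
  "delayed 0 e t r = 1"
| "delayed (Suc k) e t r =
    1 - integral {0..max 0 (r - e)} (radial_slope N (\<lambda>s. G t (delayed k e t s)))"

section \<open>Continuity and stabilisation of the delayed approximations\<close>

lemma continuous_on_G_compose:
  assumes "continuous_on S a" "continuous_on S b" "\<And>x. x \<in> S \<Longrightarrow> a x \<in> {0..1}"
  shows "continuous_on S (\<lambda>x. G (a x) (b x))"
proof -
  have "continuous_on S ((\<lambda>(t, s). G t s) \<circ> (\<lambda>x. (a x, b x)))"
    by (rule continuous_on_compose)
      (use assms in \<open>auto intro!: continuous_intros continuous_on_subset[OF cont]\<close>)
  then show ?thesis by (simp add: o_def)
qed

text \<open>Each stage adds two integrations and a root, all of which preserve joint continuity;
  continuity in \<open>t\<close> is needed for the intermediate value theorem.\<close>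

lemma continuous_on_delayed:
  assumes "0 \<le> e"
  shows "continuous_on ({0..1} \<times> {0..1}) (\<lambda>(t, r). delayed k e t r)"
proof (induction k)
  case 0
  show ?case by (simp add: case_prod_unfold)
next
  case (Suc k)
  have "continuous_on ({0..1} \<times> {0..1}) (\<lambda>p. G (fst p) (delayed k e (fst p) (snd p)))"
    using Suc by (intro continuous_on_G_compose) (auto simp: case_prod_unfold intro!: continuous_intros)
  then have "continuous_on ({0..1} \<times> {0..1})
      (\<lambda>(t, s). real N * s ^ (N - 1) * G t (delayed k e t s))"
    by (auto simp: case_prod_unfold intro!: continuous_intros)
  from continuous_on_integral_upto[OF this]
  have "continuous_on ({0..1} \<times> {0..1}) (\<lambda>(t, s). radial_slope N (\<lambda>s. G t (delayed k e t s)) s)"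
    unfolding radial_slope_def radial_mass_def by (auto simp: case_prod_unfold intro!: continuous_intros)
  from continuous_on_integral_upto[OF this]
  have *: "continuous_on ({0..1} \<times> {0..1})
      (\<lambda>(t, r). integral {0..r} (radial_slope N (\<lambda>s. G t (delayed k e t s))))" .
  have "continuous_on ({0..1} \<times> {0..1})
      ((\<lambda>(t, r). integral {0..r} (radial_slope N (\<lambda>s. G t (delayed k e t s)))) \<circ>
       (\<lambda>(t, r). (t, max 0 (r - e))))"
    by (rule continuous_on_compose)
      (use assms in \<open>auto simp: case_prod_unfold intro!: continuous_intros
        continuous_on_subset[OF *[unfolded case_prod_unfold]]\<close>)
  then show ?case
    by (auto simp: case_prod_unfold o_def intro!: continuous_intros)
qed

text \<open>The delayed integral looks back only to times up to \<open>r - e\<close>, so every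
  further stage fixes the values on one more interval of length \<open>e\<close>. Once
  \<open>(k + 1) * e\<close> reaches 1, stage \<open>k\<close> solves the delayed equation on all of
  \<open>{0..1}\<close>.\<close>

lemma delayed_Suc_eq:
  assumes "0 < e" "r \<le> real (Suc k) * e"
  shows "delayed (Suc k) e t r = delayed k e t r"
  using assms(2)
proof (induction k arbitrary: r)
  case 0
  then have "max 0 (r - e) = 0" by simp
  then show ?case by simp
next
  case (Suc k)
  have "radial_slope N (\<lambda>s. G t (delayed (Suc k) e t s)) x = radial_slope N (\<lambda>s. G t (delayed k e t s)) x"
    if "x \<in> {0..max 0 (r - e)}" for x
  proof (rule radial_slope_cong)
    fix s assume "s \<in> {0..x}"
    then have "s \<le> max 0 (r - e)" using that by auto
    also have "\<dots> \<le> real (Suc k) * e"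
      using Suc.prems assms(1) by (auto simp: algebra_simps)
    finally show "G t (delayed (Suc k) e t s) = G t (delayed k e t s)"
      using Suc.IH by simp
  qed
  then have "integral {0..max 0 (r - e)} (radial_slope N (\<lambda>s. G t (delayed (Suc k) e t s)))
    = integral {0..max 0 (r - e)} (radial_slope N (\<lambda>s. G t (delayed k e t s)))"
    by (rule integral_cong)
  then show ?case by (simp only: delayed.simps)
qed

text \<open>Compactness handles \<open>s\<close> in \<open>[0, 1]\<close>, and \<open>G\<close>
  vanishes below. Arguments up to 1 suffice because the approximations never exceed their initial
  value 1.\<close>

lemma G_bound:
  obtains M where "0 \<le> M" "\<And>t s. t \<in> {0..1} \<Longrightarrow> s \<le> 1 \<Longrightarrow> G t s \<le> M"
proof -
  have "compact ((\<lambda>(t, s). G t s) ` ({0..1} \<times> {0..1}))"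
    by (intro compact_continuous_image continuous_on_subset[OF cont] compact_Times) auto
  then obtain B where B: "\<And>x. x \<in> (\<lambda>(t, s). G t s) ` ({0..1} \<times> {0..1}) \<Longrightarrow> norm x \<le> B"
    using compact_imp_bounded bounded_iff by metis
  have "G t s \<le> \<bar>B\<bar>" if "t \<in> {0..1}" "s \<le> 1" for t s
  proof (cases "0 \<le> s")
    case True
    then have "\<bar>G t s\<bar> \<le> B" using B[of "G t s"] that by force
    then show ?thesis by simp
  qed (use zero[of t s] that in auto)
  then show ?thesis using that[of "\<bar>B\<bar>"] by simp
qed

text \<open>The bound on \<open>G\<close> makes all slopes at most \<open>L\<close>, so the
  approximations are equi-Lipschitz and Arzela-Ascoli applies. Dominated convergence, first for the
  mass and then for the integral of the slope, carries the equation to the limit.\<close>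

lemma delayed_limit:
  fixes \<theta> e :: "nat \<Rightarrow> real" and V :: "nat \<Rightarrow> real \<Rightarrow> real"
  assumes \<theta>: "\<And>n. \<theta> n \<in> {0..1}" and Vc: "\<And>n. continuous_on {0..1} (V n)"
    and e0: "\<And>n. 0 \<le> e n" and e: "e \<longlonglongrightarrow> 0"
    and eq: "\<And>n r. r \<in> {0..1} \<Longrightarrow>
      V n r = 1 - integral {0..max 0 (r - e n)} (radial_slope N (\<lambda>s. G (\<theta> n) (V n s)))"
  obtains t w \<kappa> where "t \<in> {0..1}" "strict_mono (\<kappa> :: nat \<Rightarrow> nat)"
    "\<And>r. r \<in> {0..1} \<Longrightarrow> (\<lambda>n. V (\<kappa> n) r) \<longlonglongrightarrow> w r"
    "(\<lambda>n. \<theta> (\<kappa> n)) \<longlonglongrightarrow> t" "radial_ivp N (G t) w"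
proof -
  obtain M where M: "0 \<le> M" "\<And>t s. t \<in> {0..1} \<Longrightarrow> s \<le> 1 \<Longrightarrow> G t s \<le> M"
    by (rule G_bound) blast
  define L where "L = root N M"
  have L: "0 \<le> L" using M N by (simp add: L_def)
  define k where "k n s = G (\<theta> n) (V n s)" for n s
  have kc: "continuous_on {0..1} (k n)" for n
    unfolding k_def using Vc \<theta> by (intro continuous_on_G_compose) auto
  have k0: "0 \<le> k n s" for n s
    using nonneg[OF \<theta>] by (simp add: k_def)
  define S where "S n = radial_slope N (k n)" for n
  have Sc: "continuous_on {0..1} (S n)" for n
    unfolding S_def by (rule continuous_on_radial_slope[OF kc])
  have S0: "0 \<le> S n s" if "s \<in> {0..1}" for n s
    unfolding S_def using that k0 by (intro radial_slope_nonneg[OF N kc]) auto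
  define J where "J n r = integral {0..r} (S n)" for n r
  have eq': "V n r = 1 - J n (max 0 (r - e n))" if "r \<in> {0..1}" for n r
    using eq[OF that] by (simp add: J_def S_def k_def[abs_def])
  have Jint: "S n integrable_on {0..r}" if "r \<le> 1" for n r
    using that by (intro integrable_continuous_real continuous_on_subset[OF Sc]) auto
  have in01: "max 0 (r - e n) \<in> {0..1}" if "r \<in> {0..1}" for n r
    using that e0[of n] by auto
  have J0: "0 \<le> J n r" if "r \<in> {0..1}" for n r
    unfolding J_def using that by (intro integral_nonneg Jint) (auto intro: S0)
  have V1: "V n r \<le> 1" if "r \<in> {0..1}" for n r
    using eq'[OF that] J0[OF in01[OF that]] by simp
  have kM: "k n s \<le> M" if "s \<in> {0..1}" for n s
    unfolding k_def by (rule M(2)[OF \<theta> V1[OF that]])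
  have SL: "S n s \<le> L" if "s \<in> {0..1}" for n s
  proof -
    have "radial_mass N (k n) s \<le> radial_mass N (\<lambda>_. M) s"
      using that kM by (intro radial_mass_mono[OF kc]) auto
    also have "\<dots> = M * s ^ N" using that by (intro radial_mass_const[OF N]) auto
    also have "\<dots> \<le> M * 1" using that M by (intro mult_left_mono power_le_one) auto
    finally show ?thesis using N by (simp add: S_def radial_slope_def L_def)
  qed
  have Jlip': "\<bar>J n y - J n x\<bar> \<le> L * (y - x)" if xy: "0 \<le> x" "x \<le> y" "y \<le> 1" for n x y
  proof (cases "x = y")
    case False
    then have "x < y" using xy by simp
    obtain z where "x < z" "z < y" "J n y - J n x = S n z * (y - x)"
      by (rule mvt_within[OF \<open>x < y\<close>, of "{0..1}" "J n" "S n"])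
        (use xy in \<open>auto simp: J_def[abs_def] intro!: integral_has_real_derivative[OF Sc]\<close>)
    then show ?thesis
      using SL[of z n] S0[of z n] xy by (auto simp: abs_mult intro!: mult_right_mono)
  qed simp
  have Jlip: "\<bar>J n x - J n y\<bar> \<le> L * \<bar>x - y\<bar>" if "x \<in> {0..1}" "y \<in> {0..1}" for n x y
    using Jlip'[of x y n] Jlip'[of y x n] that by (cases "x \<le> y") (auto simp: abs_minus_commute)
  have Vlip: "\<bar>V n x - V n y\<bar> \<le> L * \<bar>x - y\<bar>" if "x \<in> {0..1}" "y \<in> {0..1}" for n x y
  proof -
    have "\<bar>V n x - V n y\<bar> = \<bar>J n (max 0 (x - e n)) - J n (max 0 (y - e n))\<bar>"
      using eq' that by simp
    also have "\<dots> \<le> L * \<bar>max 0 (x - e n) - max 0 (y - e n)\<bar>"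
      by (intro Jlip in01 that)
    also have "\<dots> \<le> L * \<bar>x - y\<bar>" by (intro mult_left_mono L) auto
    finally show ?thesis .
  qed
  have Vbd: "norm (V n x) \<le> 1 + L" if "x \<in> {0..1}" for n x
  proof -
    have "\<bar>V n x - V n 0\<bar> \<le> L * \<bar>x - 0\<bar>" using that by (intro Vlip) auto
    also have "\<dots> \<le> L * 1" using that L by (intro mult_left_mono) auto
    moreover have "V n 0 = 1" using eq'[of 0 n] e0[of n] by (simp add: J_def)
    ultimately show ?thesis by auto
  qed
  \<comment> \<open>The parameters are made to converge first; Arzela-Ascoli then refines that
    subsequence.\<close>
  obtain t \<kappa>1 where t: "t \<in> {0..1}" and \<kappa>1: "strict_mono \<kappa>1" "(\<lambda>n. \<theta> (\<kappa>1 n)) \<longlonglongrightarrow> t"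
    using compact_imp_seq_compact[OF compact_Icc, of 0 "1::real"] \<theta>
    unfolding seq_compact_def o_def by metis
  obtain w \<kappa>2 where w: "continuous_on {0..1} w" and \<kappa>2: "strict_mono (\<kappa>2 :: nat \<Rightarrow> nat)"
    and unif: "\<And>\<epsilon>. 0 < \<epsilon> \<Longrightarrow> \<exists>m. \<forall>n x. m \<le> n \<and> x \<in> {0..1} \<longrightarrow> norm (V (\<kappa>1 (\<kappa>2 n)) x - w x) < \<epsilon>"
  proof (rule Arzela_Ascoli[of "{0..1}" "\<lambda>n. V (\<kappa>1 n)" "1 + L"])
    fix x \<epsilon> :: real assume x: "x \<in> {0..1}" and \<epsilon>: "0 < \<epsilon>"
    have "norm (V (\<kappa>1 n) x - V (\<kappa>1 n) y) < \<epsilon>" if "y \<in> {0..1}" "norm (x - y) < \<epsilon> / (L + 1)" for n y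
    proof -
      have "L * \<bar>x - y\<bar> \<le> (L + 1) * \<bar>x - y\<bar>" using L by (intro mult_right_mono) auto
      also have "\<dots> < \<epsilon>" using that(2) L by (simp add: field_simps)
      finally show ?thesis using Vlip[OF x that(1), of "\<kappa>1 n"] by simp
    qed
    then show "\<exists>d>0. \<forall>n y. y \<in> {0..1} \<and> norm (x - y) < d \<longrightarrow> norm (V (\<kappa>1 n) x - V (\<kappa>1 n) y) < \<epsilon>"
      using L \<epsilon> by (intro exI[of _ "\<epsilon> / (L + 1)"]) auto
  qed (use Vbd in auto)
  define \<kappa> where "\<kappa> = \<kappa>1 \<circ> \<kappa>2"
  have \<kappa>: "strict_mono \<kappa>" unfolding \<kappa>_def by (rule strict_mono_o[OF \<kappa>1(1) \<kappa>2])
  have \<theta>lim: "(\<lambda>n. \<theta> (\<kappa> n)) \<longlonglongrightarrow> t"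
    using LIMSEQ_subseq_LIMSEQ[OF \<kappa>1(2) \<kappa>2] by (simp add: \<kappa>_def o_def)
  have Vlim: "(\<lambda>n. V (\<kappa> n) r) \<longlonglongrightarrow> w r" if "r \<in> {0..1}" for r
    unfolding LIMSEQ_iff \<kappa>_def using unif that by (simp add: o_def) blast
  have elim: "(\<lambda>n. e (\<kappa> n)) \<longlonglongrightarrow> 0"
    using LIMSEQ_subseq_LIMSEQ[OF e \<kappa>] by (simp add: o_def)
  have klim: "(\<lambda>n. k (\<kappa> n) s) \<longlonglongrightarrow> G t (w s)" if "s \<in> {0..1}" for s
    using continuous_on_tendsto_compose[OF cont tendsto_Pair[OF \<theta>lim Vlim[OF that]]] t \<theta>
    by (simp add: k_def)
  have Slim: "(\<lambda>n. S (\<kappa> n) r) \<longlonglongrightarrow> radial_slope N (\<lambda>s. G t (w s)) r" if r: "r \<in> {0..1}" for r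
  proof -
    have "(\<lambda>n. radial_mass N (k (\<kappa> n)) r) \<longlonglongrightarrow> radial_mass N (\<lambda>s. G t (w s)) r"
      unfolding radial_mass_def
    proof (rule dominated_convergence(2)[where h = "\<lambda>_. real N * M"])
      fix n show "(\<lambda>s. real N * s ^ (N - 1) * k (\<kappa> n) s) integrable_on {0..r}"
        using r by (intro radial_integrand_integrable[OF kc]) auto
    next
      fix n s assume s: "s \<in> {0..r}"
      have "real N * s ^ (N - 1) * k (\<kappa> n) s \<le> real N * 1 * M"
        using s r k0 kM[of s] by (intro mult_mono power_le_one) auto
      then show "norm (real N * s ^ (N - 1) * k (\<kappa> n) s) \<le> real N * M"
        using s k0[of "\<kappa> n" s] by (simp add: abs_mult)
    next
      fix s assume "s \<in> {0..r}"
      then show "(\<lambda>n. real N * s ^ (N - 1) * k (\<kappa> n) s) \<longlonglongrightarrow> real N * s ^ (N - 1) * G t (w s)"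
        using r by (intro tendsto_intros klim) auto
    qed auto
    then show ?thesis unfolding S_def radial_slope_def by (intro tendsto_intros)
  qed
  have "w r = 1 - integral {0..r} (radial_slope N (\<lambda>s. G t (w s)))" if r: "r \<in> {0..1}" for r
  proof -
    have Jlim: "(\<lambda>n. J (\<kappa> n) r) \<longlonglongrightarrow> integral {0..r} (radial_slope N (\<lambda>s. G t (w s)))"
      unfolding J_def
    proof (rule dominated_convergence(2)[where h = "\<lambda>_. L"])
      fix n s assume "s \<in> {0..r}"
      then show "norm (S (\<kappa> n) s) \<le> L" using SL[of s] S0[of s] r by auto
    qed (use r in \<open>auto intro!: Jint Slim\<close>)
    \<comment> \<open>The delay shifts the upper limit by at most \<open>e (\<kappa> n)\<close>, and
      every \<open>J n\<close> is \<open>L\<close>-Lipschitz.\<close>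
    have Jdiff: "(\<lambda>n. J (\<kappa> n) (max 0 (r - e (\<kappa> n))) - J (\<kappa> n) r) \<longlonglongrightarrow> 0"
    proof (rule tendsto_rabs_zero_cancel, rule tendsto_sandwich[OF _ _ tendsto_const])
      have "\<bar>J (\<kappa> n) (max 0 (r - e (\<kappa> n))) - J (\<kappa> n) r\<bar> \<le> L * e (\<kappa> n)" for n
      proof -
        have "\<bar>J (\<kappa> n) (max 0 (r - e (\<kappa> n))) - J (\<kappa> n) r\<bar> \<le> L * \<bar>max 0 (r - e (\<kappa> n)) - r\<bar>"
          by (intro Jlip in01 r)
        also have "\<dots> \<le> L * e (\<kappa> n)" using r e0[of "\<kappa> n"] by (intro mult_left_mono L) auto
        finally show ?thesis .
      qed
      then show "\<forall>\<^sub>F n in sequentially. \<bar>J (\<kappa> n) (max 0 (r - e (\<kappa> n))) - J (\<kappa> n) r\<bar> \<le> L * e (\<kappa> n)"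
        by simp
      show "(\<lambda>n. L * e (\<kappa> n)) \<longlonglongrightarrow> 0"
        using tendsto_mult_right_zero[OF elim] by simp
    qed simp
    have "(\<lambda>n. J (\<kappa> n) (max 0 (r - e (\<kappa> n)))) \<longlonglongrightarrow>
        integral {0..r} (radial_slope N (\<lambda>s. G t (w s)))"
      using tendsto_add[OF Jlim Jdiff] by simp
    then have "(\<lambda>n. 1 - J (\<kappa> n) (max 0 (r - e (\<kappa> n)))) \<longlonglongrightarrow>
        1 - integral {0..r} (radial_slope N (\<lambda>s. G t (w s)))"
      by (intro tendsto_intros)
    then show ?thesis
      using LIMSEQ_unique[OF Vlim[OF r]] eq'[OF r] by simp
  qed
  then have "radial_ivp N (G t) w" using w by (simp add: radial_ivp_def)
  with that[OF t \<kappa> Vlim \<theta>lim] show ?thesis by blast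
qed

text \<open>The end signs are given for true solutions, continuity in \<open>t\<close> only for
  approximations. By compactness the signs pass to the approximations with small delay; these have
  parameters with end value 0, and a second limit turns them into a solution.\<close>

theorem shooting:
  assumes pos: "\<forall>w. radial_ivp N (G 0) w \<longrightarrow> 0 < w 1"
    and neg: "\<forall>w. radial_ivp N (G 1) w \<longrightarrow> w 1 < 0"
  obtains t w where "t \<in> {0..1}" "radial_ivp N (G t) w" "w 1 = 0"
proof -
  define e where "e n = inverse (real (Suc n))" for n
  define V where "V n t = delayed n (e n) t" for n t
  \<comment> \<open>The delays are chosen so that \<open>n + 1\<close> of them cover
    \<open>{0..1}\<close>, which makes stage \<open>n\<close> an exact solution of the delayed
    equation.\<close>
  have e: "0 < e n" "real (Suc n) * e n = 1" for n by (auto simp: e_def simp del: of_nat_Suc)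
  have elim: "e \<longlonglongrightarrow> 0" unfolding e_def by (rule LIMSEQ_inverse_real_of_nat)
  have joint: "continuous_on ({0..1} \<times> {0..1}) (\<lambda>p. V n (fst p) (snd p))" for n
    using continuous_on_delayed[of "e n" n] e[of n] by (simp add: V_def case_prod_unfold)
  have Vt: "continuous_on {0..1} (\<lambda>t. V n t 1)" for n
    by (rule continuous_on_compose2[OF joint[of n], of "{0..1}" "\<lambda>t. (t, 1)", simplified])
      (auto intro!: continuous_intros)
  have Vr: "continuous_on {0..1} (V n t)" if "t \<in> {0..1}" for n t
    by (rule continuous_on_compose2[OF joint[of n], of "{0..1}" "\<lambda>r. (t, r)", simplified])
      (use that in \<open>auto intro!: continuous_intros\<close>)
  have Veq: "V n t r = 1 - integral {0..max 0 (r - e n)} (radial_slope N (\<lambda>s. G t (V n t s)))"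
    if "r \<in> {0..1}" for n t r
  proof -
    have "V n t r = delayed (Suc n) (e n) t r"
      using delayed_Suc_eq[of "e n" r n t] e[of n] that by (simp add: V_def)
    then show ?thesis by (simp add: V_def)
  qed
  \<comment> \<open>The index sequence \<open>f\<close> stays free: the sign arguments run it
    through the bad indices, the final one uses a shift.\<close>
  have limit: "\<exists>t w \<kappa>. t \<in> {0..1} \<and> strict_mono \<kappa> \<and> (\<lambda>n. V (f (\<kappa> n)) (\<theta> (\<kappa> n)) 1) \<longlonglongrightarrow> w 1 \<and>
      (\<lambda>n. \<theta> (\<kappa> n)) \<longlonglongrightarrow> t \<and> radial_ivp N (G t) w"
    if f: "strict_mono f" and \<theta>: "\<And>n. \<theta> n \<in> {0..1}" for f :: "nat \<Rightarrow> nat" and \<theta>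
  proof -
    have ef: "(\<lambda>n. e (f n)) \<longlonglongrightarrow> 0"
      using LIMSEQ_subseq_LIMSEQ[OF elim f] by (simp add: o_def)
    obtain t w \<kappa> where "t \<in> {0..1}" "strict_mono \<kappa>"
      "\<And>r. r \<in> {0..1} \<Longrightarrow> (\<lambda>n. V (f (\<kappa> n)) (\<theta> (\<kappa> n)) r) \<longlonglongrightarrow> w r"
      "(\<lambda>n. \<theta> (\<kappa> n)) \<longlonglongrightarrow> t" "radial_ivp N (G t) w"
      by (rule delayed_limit[of \<theta> "\<lambda>n. V (f n) (\<theta> n)" "\<lambda>n. e (f n)", OF \<theta> Vr[OF \<theta>] _ ef Veq])
        (use e in \<open>auto simp: less_imp_le\<close>)
    then show ?thesis by (intro exI[of _ t] exI[of _ w] exI[of _ \<kappa>]) simp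
  qed
  \<comment> \<open>Infinitely many failures would yield, in the limit, a solution for
    \<open>G 0\<close> with \<open>w 1 \<le> 0\<close>.\<close>
  have ev0: "\<forall>\<^sub>F n in sequentially. 0 < V n 0 1"
  proof (rule ccontr)
    assume "\<not> ?thesis"
    then obtain f :: "nat \<Rightarrow> nat" where f: "strict_mono f" "\<And>n. \<not> 0 < V (f n) 0 1"
      using not_eventually_sequentiallyD by blast
    obtain t w \<kappa> where w: "(\<lambda>n. V (f (\<kappa> n)) 0 1) \<longlonglongrightarrow> w 1"
      "(\<lambda>n::nat. 0) \<longlonglongrightarrow> t" "radial_ivp N (G t) w"
      using limit[OF f(1), of "\<lambda>_. 0"] by auto
    have "t = 0" using w(2) LIMSEQ_const_iff by metis
    moreover have "w 1 \<le> 0"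
      by (rule LIMSEQ_le_const2[OF w(1)]) (use f(2) not_less in blast)
    ultimately show False using pos w(3) by force
  qed
  have ev1: "\<forall>\<^sub>F n in sequentially. V n 1 1 < 0"
  proof (rule ccontr)
    assume "\<not> ?thesis"
    then obtain f :: "nat \<Rightarrow> nat" where f: "strict_mono f" "\<And>n. \<not> V (f n) 1 1 < 0"
      using not_eventually_sequentiallyD by blast
    obtain t w \<kappa> where w: "(\<lambda>n. V (f (\<kappa> n)) 1 1) \<longlonglongrightarrow> w 1"
      "(\<lambda>n::nat. 1) \<longlonglongrightarrow> t" "radial_ivp N (G t) w"
      using limit[OF f(1), of "\<lambda>_. 1"] by auto
    have "t = 1" using w(2) LIMSEQ_const_iff by metis
    moreover have "0 \<le> w 1"
      by (rule LIMSEQ_le_const[OF w(1)]) (use f(2) not_less in blast)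
    ultimately show False using neg w(3) by force
  qed
  obtain m where m: "\<And>n. m \<le> n \<Longrightarrow> 0 < V n 0 1 \<and> V n 1 1 < 0"
    using eventually_conj[OF ev0 ev1] unfolding eventually_sequentially by auto
  have "\<exists>t\<in>{0..1}. V (n + m) t 1 = 0" for n
    using IVT2'[OF _ _ _ Vt[of "n + m"], of 0] m[of "n + m"] by force
  then obtain \<theta> where \<theta>: "\<And>n. \<theta> n \<in> {0..1}" "\<And>n. V (n + m) (\<theta> n) 1 = 0"
    by metis
  obtain t w \<kappa> where w: "t \<in> {0..1}" "(\<lambda>n. V (\<kappa> n + m) (\<theta> (\<kappa> n)) 1) \<longlonglongrightarrow> w 1" "radial_ivp N (G t) w"
    using limit[of "\<lambda>n. n + m" \<theta>] \<theta>(1) by (auto simp: strict_mono_def)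
  have "w 1 = 0" using w(2) \<theta>(2) by (simp add: LIMSEQ_const_iff)
  with that w show ?thesis by blast
qed

end

section \<open>The first eigenvalue\<close>

lemma radial_ivp_deriv:
  assumes g: "continuous_on UNIV g" and w: "radial_ivp N g w" and r: "r \<in> {0..1}"
  shows "(w has_real_derivative - radial_slope N (\<lambda>s. g (w s)) r) (at r within {0..1})"
proof -
  have wc: "continuous_on {0..1} w" using w by (simp add: radial_ivp_def)
  have "continuous_on {0..1} (\<lambda>s. g (w s))"
    by (rule continuous_on_compose2[OF g wc]) simp
  then have "((\<lambda>r. 1 - integral {0..r} (radial_slope N (\<lambda>s. g (w s)))) has_real_derivative
      0 - radial_slope N (\<lambda>s. g (w s)) r) (at r within {0..1})"
    by (intro DERIV_diff DERIV_const integral_has_real_derivative continuous_on_radial_slope r)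
  then have "((\<lambda>r. 1 - integral {0..r} (radial_slope N (\<lambda>s. g (w s)))) has_real_derivative
      - radial_slope N (\<lambda>s. g (w s)) r) (at r within {0..1})" by simp
  then show ?thesis
    by (rule has_field_derivative_transform_within[where d = 1])
      (use w r in \<open>auto simp: radial_ivp_def\<close>)
qed

text \<open>Because \<open>w 0 = 1\<close>, the assumption \<open>0 < g 1\<close> makes the slope
  positive at every positive radius, even after \<open>w\<close> has crossed zero.\<close>

lemma radial_ivp_strict_antimono:
  assumes N: "N \<ge> 1" and g: "continuous_on UNIV g" and g0: "\<And>s. 0 \<le> g s" and g1: "0 < g 1"
    and w: "radial_ivp N g w" and xy: "0 \<le> x" "x < y" "y \<le> 1"
  shows "w y < w x"
proof (rule deriv_neg_imp_less_within[where S = "{0..1}", OF _ _ radial_ivp_deriv[OF g w]])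
  fix z assume z: "z \<in> {x<..<y}"
  have wc: "continuous_on {0..1} w" and "w 0 = 1" using w by (auto simp: radial_ivp_def)
  have "continuous_on {0..1} (\<lambda>s. g (w s))"
    by (rule continuous_on_compose2[OF g wc]) simp
  then show "- radial_slope N (\<lambda>s. g (w s)) z < 0"
    using radial_slope_pos[OF N, of 1 "\<lambda>s. g (w s)" z] z xy g0 g1 \<open>w 0 = 1\<close> by simp
qed (use xy in auto)

lemma continuous_max_power: "continuous_on UNIV (\<lambda>s::real. c * max 0 s ^ N)"
  by (intro continuous_intros)

text \<open>As long as \<open>w\<close> has not become negative the truncation is inactive, and
  homogeneity extracts the factor \<open>c\<close>.\<close>

lemma eigen_ivp:
  assumes N: "N \<ge> 1" and c: "0 < c" and w: "radial_ivp N (\<lambda>s. c ^ N * max 0 s ^ N) w"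
    and R: "0 < R" "R \<le> 1" "0 \<le> w R"
  shows "\<And>r. r \<in> {0..<R} \<Longrightarrow> 0 < w r"
    and "\<And>r. r \<in> {0..R} \<Longrightarrow>
      (w has_real_derivative - (c * radial_slope N (\<lambda>s. w s ^ N) r)) (at r within {0..R})"
proof -
  show pos: "0 < w r" if "r \<in> {0..<R}" for r
    using radial_ivp_strict_antimono[OF N continuous_max_power _ _ w, of r R] that R c by auto
  show "(w has_real_derivative - (c * radial_slope N (\<lambda>s. w s ^ N) r)) (at r within {0..R})"
    if r: "r \<in> {0..R}" for r
  proof -
    have "radial_slope N (\<lambda>s. c ^ N * max 0 (w s) ^ N) r = radial_slope N (\<lambda>s. c ^ N * w s ^ N) r"
    proof (rule radial_slope_cong)
      fix s assume "s \<in> {0..r}"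
      then have "0 \<le> w s" using pos[of s] R r by (cases "s = R") (auto intro: less_imp_le)
      then show "c ^ N * max 0 (w s) ^ N = c ^ N * w s ^ N" by simp
    qed
    also have "\<dots> = c * radial_slope N (\<lambda>s. w s ^ N) r"
      using radial_slope_cmult[OF N] c by simp
    finally show ?thesis
      using radial_ivp_deriv[OF continuous_max_power w, of r] r R
      by (auto intro: has_field_derivative_subset)
  qed
qed

lemma radial_slope_power_has_derivative:
  assumes N: "N \<ge> 1" and k: "continuous_on {0..1} k" and k0: "\<And>s. s \<in> {0..1} \<Longrightarrow> 0 \<le> k s"
    and r: "r \<in> {0<..<1}"
  shows "((\<lambda>s. radial_slope N k s ^ N) has_real_derivative real N * r ^ (N - 1) * k r) (at r)"
proof -
  have "(radial_mass N k has_real_derivative real N * r ^ (N - 1) * k r) (at r within {0..1})"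
    using r by (intro radial_mass_has_derivative[OF k]) auto
  then have "(radial_mass N k has_real_derivative real N * r ^ (N - 1) * k r) (at r)"
    using r by (simp add: at_within_Icc_at)
  then show ?thesis
    by (rule has_field_derivative_transform_within_open[of _ _ _ "{0<..<1}"])
      (use r k0 in \<open>auto intro!: radial_slope_power[OF N k, symmetric]\<close>)
qed

lemma eigen_solutionI:
  assumes N: "N \<ge> 1" and lam: "0 < lam"
    and der: "\<And>r. r \<in> {0..1} \<Longrightarrow>
      (v has_real_derivative - (lam * radial_slope N (\<lambda>s. v s ^ N) r)) (at r within {0..1})"
    and pos: "\<And>r. r \<in> {0..<1} \<Longrightarrow> 0 < v r" and v1: "v 1 = 0"
  shows "eigen_solution N lam v"
proof -
  let ?S = "radial_slope N (\<lambda>s. v s ^ N)"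
  have "continuous_on {0..1} v" by (auto intro!: DERIV_continuous_on der)
  then have k: "continuous_on {0..1} (\<lambda>s. v s ^ N)" by (intro continuous_intros)
  have k0: "0 \<le> v s ^ N" if "s \<in> {0..1}" for s
    using pos[of s] v1 N that by (cases "s = 1") (auto simp: power_0_left intro: less_imp_le)
  obtain q where q: "continuous_on {0..1} q"
    "\<And>r. r \<in> {0..1} \<Longrightarrow> (?S has_real_derivative q r) (at r within {0..1})"
    by (rule radial_slope_C1[OF N k]) (use pos in auto)
  show ?thesis
    unfolding eigen_solution_def
  proof (rule exI[of _ "\<lambda>r. - (lam * ?S r)"], rule exI[of _ "\<lambda>r. - (lam * q r)"], intro conjI ballI)
    fix r :: real assume r: "r \<in> {0..1}"
    show "(v has_real_derivative - (lam * ?S r)) (at r within {0..1})" by (rule der[OF r])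
    show "((\<lambda>r. - (lam * ?S r)) has_real_derivative - (lam * q r)) (at r within {0..1})"
      by (intro DERIV_minus DERIV_cmult q r)
  next
    fix r :: real assume r: "r \<in> {0<..<1}"
    have "((\<lambda>s. lam ^ N * ?S s ^ N) has_real_derivative lam ^ N * (real N * r ^ (N - 1) * v r ^ N)) (at r)"
      by (intro DERIV_cmult radial_slope_power_has_derivative[OF N k k0 r]) auto
    then show "((\<lambda>s. (- (- (lam * ?S s))) ^ N) has_real_derivative
        lam ^ N * real N * r ^ (N - 1) * v r ^ N) (at r)"
      by (simp add: power_mult_distrib mult.assoc)
  qed (use q v1 in \<open>auto intro!: continuous_intros\<close>)
qed

text \<open>Here the shooting parameter is the eigenvalue itself, \<open>5 * t\<close>: for
  \<open>t = 0\<close> the solution is constantly 1, and for \<open>t = 1\<close> it has crossed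
  zero.\<close>

lemma first_eigenvalue:
  assumes N: "N \<ge> 1"
  obtains v where "0 < first_eigenvalue N" "eigen_solution N (first_eigenvalue N) v"
    "\<forall>r\<in>{0<..<1}. 0 < v r"
proof -
  \<comment> \<open>Any constant above 4 would do in place of 5: if \<open>w 1\<close> were
    nonnegative, the slope integral on \<open>[1 / 2, 1]\<close> would be at least
    \<open>w (1 / 2) / 2\<close>, and \<open>w\<close> would drop there by at least
    \<open>5 / 4 * w (1 / 2)\<close>.\<close>
  define G where "G t s = (5 * t) ^ N * max 0 s ^ N" for t s :: real
  interpret radial_family N G
  proof
    show "continuous_on ({0..1} \<times> UNIV) (\<lambda>(t, s). G t s)"
      unfolding G_def case_prod_unfold by (intro continuous_intros)
    show "G t s = 0" if "s \<le> 0" for t s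
      using that N by (simp add: G_def max_def)
  qed (use N in \<open>auto simp: G_def\<close>)
  have pos: "\<forall>w. radial_ivp N (G 0) w \<longrightarrow> 0 < w 1"
  proof (intro allI impI)
    fix w assume w: "radial_ivp N (G 0) w"
    have "radial_slope N (\<lambda>s. G 0 (w s)) = (\<lambda>r. 0)"
      using N by (simp add: fun_eq_iff radial_slope_def radial_mass_def G_def power_0_left)
    then show "0 < w 1" using w by (simp add: radial_ivp_def)
  qed
  have neg: "\<forall>w. radial_ivp N (G 1) w \<longrightarrow> w 1 < 0"
  proof (intro allI impI, rule ccontr)
    fix w assume w: "radial_ivp N (G 1) w"
    assume "\<not> w 1 < 0"
    then have w1: "0 \<le> w 1" by simp
    have w': "radial_ivp N (\<lambda>s. 5 ^ N * max 0 s ^ N) w"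
      using w by (simp add: G_def[abs_def])
    note wp = eigen_ivp[OF N _ w' zero_less_one order_refl w1, simplified]
    have wc: "continuous_on {0..1} w" using w by (simp add: radial_ivp_def)
    then have wNc: "continuous_on {0..1} (\<lambda>s. w s ^ N)" by (intro continuous_intros)
    have w0: "0 \<le> w s" if "s \<in> {0..1}" for s
      using wp(1)[of s] w1 that by (cases "s = 1") (auto intro: less_imp_le)
    let ?h = "w (1 / 2)"
    have h: "0 < ?h" by (rule wp(1)) auto
    obtain z where z: "1 / 2 < z" "z < 1"
      "w 1 - ?h = - (5 * radial_slope N (\<lambda>s. w s ^ N) z) * (1 - 1 / 2)"
      by (rule mvt_within[of "1 / 2" 1 "{0..1}" w "\<lambda>r. - (5 * radial_slope N (\<lambda>s. w s ^ N) r)"])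
        (use wp(2) in auto)
    have anti: "?h \<le> w s" if "s \<in> {0..1 / 2}" for s
    proof (cases "s < 1 / 2")
      case True
      then show ?thesis
        using radial_ivp_strict_antimono[OF N continuous_max_power _ _ w', of s "1 / 2"] that by auto
    next
      case False
      with that have "s = 1 / 2" by simp
      then show ?thesis by (simp only: order.refl)
    qed
    have "?h * (1 / 2) = root N (radial_mass N (\<lambda>_. ?h ^ N) (1 / 2))"
      using radial_mass_const[OF N, of "1 / 2"] N h
      by (simp add: real_root_mult real_root_power_cancel real_root_divide power_divide)
    also have "\<dots> = radial_slope N (\<lambda>_. ?h ^ N) (1 / 2)"
      by (simp add: radial_slope_def)
    also have "\<dots> \<le> radial_slope N (\<lambda>s. w s ^ N) (1 / 2)"
      using anti h by (intro radial_slope_mono[OF N _ wNc] power_mono) auto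
    also have "\<dots> \<le> radial_slope N (\<lambda>s. w s ^ N) z"
      using z w0 by (intro radial_slope_mono_radius[OF N wNc]) auto
    finally show False using z(3) w1 h by simp
  qed
  obtain t w where t: "t \<in> {0..1}" and w: "radial_ivp N (G t) w" "w 1 = 0"
    using shooting[OF pos neg] by blast
  have "t \<noteq> 0" using pos w by force
  with t have lam: "0 < 5 * t" by simp
  have w': "radial_ivp N (\<lambda>s. (5 * t) ^ N * max 0 s ^ N) w"
    using w by (simp add: G_def[abs_def])
  note wp = eigen_ivp[OF N lam w' zero_less_one order_refl, unfolded w(2), OF order_refl]
  have sol: "eigen_solution N (5 * t) w"
    by (rule eigen_solutionI[OF N lam wp(2,1) w(2)])
  moreover have p: "\<forall>r\<in>{0<..<1}. 0 < w r" using wp(1) by auto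
  ultimately show ?thesis
    using that lam first_eigenvalue_eqI[OF N lam sol p] by simp
qed

text \<open>Both signs come from \<open>radial_eigen_comparison\<close> with the eigenfunction
  \<open>v\<close>. If \<open>w\<close> has a zero \<open>R\<close> in \<open>(0, 1]\<close>, the
  comparison on \<open>[0, R]\<close> gives \<open>first_eigenvalue N \<le> c\<close>; if
  \<open>w 1\<close> is nonnegative, exchanged roles on \<open>[0, 1]\<close> give the reverse
  inequality.\<close>

lemma eigen_ivp_end_sign:
  assumes N: "N \<ge> 1" and c: "0 < c" and w: "radial_ivp N (\<lambda>s. c ^ N * max 0 s ^ N) w"
  shows "c < first_eigenvalue N \<Longrightarrow> 0 < w 1" and "first_eigenvalue N < c \<Longrightarrow> w 1 < 0"
proof -
  obtain v where lam: "0 < first_eigenvalue N" and v: "eigen_solution N (first_eigenvalue N) v"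
    "\<forall>r\<in>{0<..<1}. 0 < v r"
    using first_eigenvalue[OF N] .
  note V = eigen_solution_deriv[OF N lam v]
  have wc: "continuous_on {0..1} w" and w0: "w 0 = 1" using w by (auto simp: radial_ivp_def)
  show "0 < w 1" if "c < first_eigenvalue N"
  proof (rule ccontr)
    assume "\<not> 0 < w 1"
    \<comment> \<open>Any zero will do, since strict decrease makes \<open>w\<close> positive before
      it.\<close>
    then obtain R where R: "0 \<le> R" "R \<le> 1" "w R = 0"
      using IVT2'[of w 1 0 0] wc w0 by auto
    then have "0 < R" using w0 by (cases "R = 0") auto
    have wR: "0 \<le> w R" using R by simp
    note W = eigen_ivp[OF N c w \<open>0 < R\<close> R(2) wR]
    have "0 \<le> v R" using V(1) V(2)[of R] R by (cases "R = 1") auto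
    have VR: "(v has_real_derivative - (first_eigenvalue N * radial_slope N (\<lambda>s. v s ^ N) r))
        (at r within {0..R})" "r < R \<Longrightarrow> 0 < v r" if "r \<in> {0..R}" for r
      using V(2)[of r] R that by (auto intro!: has_field_derivative_subset[OF V(3)])
    have "first_eigenvalue N \<le> c"
      by (rule radial_eigen_comparison[where R = R and v = w and w = v])
        (use N c W R \<open>0 < R\<close> \<open>0 \<le> v R\<close> VR in auto)
    with that show False by simp
  qed
  show "w 1 < 0" if "first_eigenvalue N < c"
  proof (rule ccontr)
    assume "\<not> w 1 < 0"
    then have w1: "0 \<le> w 1" by simp
    note W = eigen_ivp[OF N c w zero_less_one order_refl w1]
    have "c \<le> first_eigenvalue N"
      by (rule radial_eigen_comparison[OF N zero_less_one lam V(3) W(2) V(2) W(1) V(1) w1])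
    with that show False by simp
  qed
qed

section \<open>Existence of solutions\<close>

text \<open>\<open>shooting\<close> expects the positive sign at \<open>t = 0\<close>; reversal
  covers the other order of the two limiting problems.\<close>

lemma radial_family_reverse:
  assumes "radial_family N G"
  shows "radial_family N (\<lambda>t. G (1 - t))"
proof -
  interpret radial_family N G by fact
  show ?thesis
  proof
    show "continuous_on ({0..1} \<times> UNIV) (\<lambda>(t, s). G (1 - t) s)"
      unfolding case_prod_unfold by (intro continuous_on_G_compose continuous_intros) auto
  qed (use N nonneg zero in auto)
qed

text \<open>The parameter \<open>\<theta> = x / (1 + x)\<close> compactifies the half line \<open>x > 0\<close>.\<close>

lemma continuous_on_compactified_ratio:
  fixes \<phi> :: "real \<Rightarrow> real"
  assumes \<phi>: "continuous_on {0<..} \<phi>" and a: "(\<phi> \<longlongrightarrow> a) (at_right 0)" and b: "(\<phi> \<longlongrightarrow> b) at_top"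
  shows "continuous_on {0..1} (\<lambda>\<theta>. if \<theta> \<le> 0 then a else if 1 \<le> \<theta> then b else \<phi> (\<theta> / (1 - \<theta>)))"
    (is "continuous_on _ ?\<psi>")
proof (rule continuous_on_IccI)
  have ev0: "\<forall>\<^sub>F \<theta> in at_right (0::real). \<theta> \<in> {0<..<1}"
    by (rule eventually_at_right_real) simp
  have ev1: "\<forall>\<^sub>F \<theta> in at_left (1::real). \<theta> \<in> {0<..<1}"
    by (rule eventually_at_left_real) simp
  have "((\<lambda>\<theta>::real. \<theta> / (1 - \<theta>)) \<longlongrightarrow> 0 / (1 - 0)) (at_right 0)"
    by (intro tendsto_intros) auto
  then have "filterlim (\<lambda>\<theta>::real. \<theta> / (1 - \<theta>)) (at_right 0) (at_right 0)"
    unfolding filterlim_at using eventually_mono[OF ev0] by auto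
  from filterlim_compose[OF a this] have "((\<lambda>\<theta>. \<phi> (\<theta> / (1 - \<theta>))) \<longlongrightarrow> ?\<psi> 0) (at_right 0)"
    by simp
  then show "(?\<psi> \<longlongrightarrow> ?\<psi> 0) (at_right 0)"
    by (rule Lim_transform_eventually) (use ev0 in \<open>auto elim!: eventually_mono\<close>)
  have "((\<lambda>\<theta>::real. 1 - \<theta>) \<longlongrightarrow> 1 - 1) (at_left 1)"
    by (intro tendsto_intros)
  then have "filterlim (\<lambda>\<theta>::real. 1 - \<theta>) (at_right 0) (at_left 1)"
    unfolding filterlim_at using eventually_mono[OF ev1] by auto
  from filterlim_compose[OF filterlim_inverse_at_top_right this]
  have "filterlim (\<lambda>\<theta>::real. \<theta> * inverse (1 - \<theta>)) at_top (at_left 1)"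
    by (intro filterlim_tendsto_pos_mult_at_top[where c = 1] tendsto_intros) auto
  then have "filterlim (\<lambda>\<theta>::real. \<theta> / (1 - \<theta>)) at_top (at_left 1)"
    by (simp add: divide_inverse)
  from filterlim_compose[OF b this] have "((\<lambda>\<theta>. \<phi> (\<theta> / (1 - \<theta>))) \<longlongrightarrow> ?\<psi> 1) (at_left 1)"
    by simp
  then show "(?\<psi> \<longlongrightarrow> ?\<psi> 1) (at_left 1)"
    by (rule Lim_transform_eventually) (use ev1 in \<open>auto elim!: eventually_mono\<close>)
next
  fix x :: real assume x: "0 < x" "x < 1"
  have "continuous_on {0<..<1} (\<lambda>\<theta>. \<phi> (\<theta> / (1 - \<theta>)))"
    by (rule continuous_on_compose2[OF \<phi>]) (auto intro!: continuous_intros)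
  then have "continuous_on {0<..<1} ?\<psi>"
    by (rule continuous_on_eq) auto
  then show "(?\<psi> \<longlongrightarrow> ?\<psi> x) (at x)"
    using x by (simp add: continuous_on_eq_continuous_at isCont_def)
qed simp

text \<open>The argument of \<open>\<psi>\<close> is \<open>x / (1 + x)\<close> for
  \<open>x = t / (1 - t) * s\<close>. It has no limit at \<open>t = 1\<close>, \<open>s = 0\<close>,
  but \<open>\<psi>\<close> is bounded and the factor \<open>max 0 s ^ N\<close> tends to 0
  there.\<close>

lemma continuous_on_power_times_bounded:
  fixes \<psi> :: "real \<Rightarrow> real"
  assumes N: "N \<ge> 1" and \<psi>: "continuous_on {0..1} \<psi>"
  shows "continuous_on ({0..1} \<times> UNIV) (\<lambda>(t, s). max 0 s ^ N * \<psi> (t * s / (1 - t + t * s)))"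
    (is "continuous_on _ ?F")
proof -
  have den: "0 < 1 - t + t * s" if "t \<in> {0..1}" "0 < s" for t s :: real
    using that by (cases "t = 1") (auto intro: add_pos_nonneg)
  have \<theta>: "t * s / (1 - t + t * s) \<in> {0..1}" if "t \<in> {0..1}" "0 < s" for t s :: real
    using that den[OF that] by (auto simp: field_simps)
  obtain K where K: "\<And>x. x \<in> {0..1} \<Longrightarrow> \<bar>\<psi> x\<bar> \<le> K"
    using compact_continuous_image[OF \<psi> compact_Icc] compact_imp_bounded bounded_iff
    by (metis (no_types, lifting) imageI real_norm_def)
  have pos: "continuous_on ({0..1} \<times> {0<..}) ?F"
  proof -
    have "continuous_on ({0..1} \<times> {0<..}) (\<lambda>p::real \<times> real. \<psi> (fst p * snd p / (1 - fst p + fst p * snd p)))"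
      by (rule continuous_on_compose2[OF \<psi>])
        (use den \<theta> in \<open>fastforce intro!: continuous_intros simp: order.strict_iff_not\<close>)+
    then show ?thesis unfolding case_prod_unfold by (intro continuous_intros)
  qed
  show ?thesis
    unfolding continuous_on_def
  proof
    fix p :: "real \<times> real" assume p: "p \<in> {0..1} \<times> UNIV"
    show "(?F \<longlongrightarrow> ?F p) (at p within {0..1} \<times> UNIV)"
    proof (cases "0 < snd p")
      case True
      have "at p within {0..1} \<times> UNIV = at p within {0..1} \<times> {0<..}"
        by (rule at_within_nhd[of p "UNIV \<times> {0<..}"])
          (use True in \<open>auto simp: open_Times mem_Times_iff\<close>)
      moreover have "p \<in> {0..1} \<times> {0<..}" using p True by (auto simp: mem_Times_iff)
      ultimately show ?thesis
        using pos[unfolded continuous_on_def, rule_format, of p] by (simp only:)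
    next
      case False
      have Fp: "?F p = 0" using False N by (simp add: case_prod_unfold max_def)
      have "((\<lambda>q. max 0 (snd q) ^ N * K) \<longlongrightarrow> max 0 (snd p) ^ N * K) (at p within {0..1} \<times> UNIV)"
        by (intro tendsto_intros)
      then have "((\<lambda>q. max 0 (snd q) ^ N * K) \<longlongrightarrow> 0) (at p within {0..1} \<times> UNIV)"
        using False N by (simp add: max_absorb1 power_0_left)
      moreover have "\<bar>?F q\<bar> \<le> max 0 (snd q) ^ N * K" if "q \<in> {0..1} \<times> UNIV" for q
      proof (cases "0 < snd q")
        case True
        then show ?thesis
          using K[OF \<theta>[of "fst q" "snd q"]] that
          by (auto simp: case_prod_unfold abs_mult intro!: mult_left_mono)
      qed (use N in \<open>auto simp: case_prod_unfold max_def power_0_left\<close>)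
      then have "\<forall>\<^sub>F q in at p within {0..1} \<times> UNIV. norm (?F q) \<le> max 0 (snd q) ^ N * K"
        by (auto simp: eventually_at_filter)
      ultimately have "(?F \<longlongrightarrow> 0) (at p within {0..1} \<times> UNIV)"
        by (rule Lim_null_comparison[rotated])
      then show ?thesis by (simp only: Fp)
    qed
  qed
qed

text \<open>At amplitude 0 and infinity the problem becomes an eigenvalue problem with constant
  \<open>lam * A\<close> or \<open>lam * B\<close>. By \<open>between\<close> these lie on opposite
  sides of the first eigenvalue, so \<open>eigen_ivp_end_sign\<close> supplies the opposite signs
  for the shooting.\<close>

lemma positive_radial_solution:
  fixes h :: "real \<Rightarrow> real"
  assumes N: "N \<ge> 1" and h: "continuous_on UNIV h" and h_pos: "\<And>s. 0 < s \<Longrightarrow> 0 < h s"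
    and A: "0 < A" "((\<lambda>s. h s / s ^ N) \<longlongrightarrow> A ^ N) (at_right 0)"
    and B: "0 < B" "((\<lambda>s. h s / s ^ N) \<longlongrightarrow> B ^ N) at_top"
    and lam: "0 < lam"
    and between: "lam * A < first_eigenvalue N \<and> first_eigenvalue N < lam * B \<or>
      lam * B < first_eigenvalue N \<and> first_eigenvalue N < lam * A"
  obtains u where "u 1 = 0" "\<And>r. r \<in> {0..<1} \<Longrightarrow> 0 < u r"
    "\<And>r. r \<in> {0..1} \<Longrightarrow>
      (u has_real_derivative - radial_slope N (\<lambda>s. lam ^ N * h (u s)) r) (at r within {0..1})"
proof -
  have "((\<lambda>s. h s / s ^ N * s ^ N) \<longlongrightarrow> A ^ N * 0 ^ N) (at_right 0)"
    by (intro tendsto_intros A)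
  then have "(h \<longlongrightarrow> A ^ N * 0 ^ N) (at_right 0)"
    by (rule Lim_transform_eventually) (auto simp: eventually_at_filter)
  moreover have "(h \<longlongrightarrow> h 0) (at_right 0)"
    using h by (auto simp: continuous_on_def intro: tendsto_within_subset)
  ultimately have h0: "h 0 = 0"
    using N tendsto_unique[of "at_right (0::real)"] by (fastforce simp: power_0_left)
  define \<psi> where "\<psi> \<theta> = (if \<theta> \<le> 0 then A ^ N else if 1 \<le> \<theta> then B ^ N
      else h (\<theta> / (1 - \<theta>)) / (\<theta> / (1 - \<theta>)) ^ N)" for \<theta>
  have \<psi>c: "continuous_on {0..1} \<psi>"
    unfolding \<psi>_def
    by (rule continuous_on_compactified_ratio[OF _ A(2) B(2)])
      (auto intro!: continuous_intros continuous_on_subset[OF h])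
  have \<psi>_pos: "0 < \<psi> \<theta>" for \<theta>
    using A B h_pos by (simp add: \<psi>_def)
  \<comment> \<open>For \<open>0 < t < 1\<close> and \<open>s > 0\<close> this is
    \<open>lam ^ N * h (d * s) / d ^ N\<close> with amplitude \<open>d = t / (1 - t)\<close>,
    written so that it extends continuously to \<open>d = 0\<close> and to infinite
    \<open>d\<close>.\<close>
  define G where "G t s = lam ^ N * (max 0 s ^ N * \<psi> (t * s / (1 - t + t * s)))" for t s
  interpret G: radial_family N G
  proof
    show "continuous_on ({0..1} \<times> UNIV) (\<lambda>(t, s). G t s)"
      using continuous_on_power_times_bounded[OF N \<psi>c]
      unfolding G_def case_prod_unfold by (rule continuous_on_mult_left)
    show "G t s = 0" if "s \<le> 0" for t s
      using that N by (simp add: G_def max_def)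
    show "0 \<le> G t s" for t s
      using lam \<psi>_pos[of "t * s / (1 - t + t * s)"] by (simp add: G_def)
  qed (rule N)
  have G0: "G 0 = (\<lambda>s. (lam * A) ^ N * max 0 s ^ N)"
    by (simp add: fun_eq_iff G_def \<psi>_def power_mult_distrib)
  have "G 1 s = (lam * B) ^ N * max 0 s ^ N" for s
    using N by (cases "0 < s") (auto simp: G_def \<psi>_def power_mult_distrib max_def)
  then have G1: "G 1 = (\<lambda>s. (lam * B) ^ N * max 0 s ^ N)" by auto
  have pos: "0 < lam * A" "0 < lam * B" using lam A B by auto
  have "\<exists>t w. t \<in> {0<..<1} \<and> radial_ivp N (G t) w \<and> w 1 = 0"
    using between
  proof
    assume *: "lam * A < first_eigenvalue N \<and> first_eigenvalue N < lam * B"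
    have s0: "\<forall>w. radial_ivp N (G 0) w \<longrightarrow> 0 < w 1"
      using eigen_ivp_end_sign(1)[OF N pos(1)] * by (simp add: G0)
    have s1: "\<forall>w. radial_ivp N (G 1) w \<longrightarrow> w 1 < 0"
      using eigen_ivp_end_sign(2)[OF N pos(2)] * by (simp add: G1)
    obtain t w where t: "t \<in> {0..1}" "radial_ivp N (G t) w" "w 1 = 0"
      using G.shooting[OF s0 s1] by blast
    \<comment> \<open>The strict end signs exclude both limiting problems, so the amplitude is
      positive and finite.\<close>
    then have "t \<noteq> 0" "t \<noteq> 1" using s0 s1 by force+
    with t show ?thesis by (intro exI[of _ t] exI[of _ w]) auto
  next
    assume *: "lam * B < first_eigenvalue N \<and> first_eigenvalue N < lam * A"
    have s0: "\<forall>w. radial_ivp N (G (1 - 0)) w \<longrightarrow> 0 < w 1"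
      using eigen_ivp_end_sign(1)[OF N pos(2)] * by (simp add: G1)
    have s1: "\<forall>w. radial_ivp N (G (1 - 1)) w \<longrightarrow> w 1 < 0"
      using eigen_ivp_end_sign(2)[OF N pos(1)] * by (simp add: G0)
    obtain t w where t: "t \<in> {0..1}" "radial_ivp N (G (1 - t)) w" "w 1 = 0"
      using radial_family.shooting[OF radial_family_reverse[OF G.radial_family_axioms] s0 s1] by blast
    then have "t \<noteq> 0" "t \<noteq> 1" using s0 s1 by force+
    with t show ?thesis by (intro exI[of _ "1 - t"] exI[of _ w]) auto
  qed
  then obtain t w where t: "0 < t" "t < 1" and w: "radial_ivp N (G t) w" and w1: "w 1 = 0"
    by auto
  define d where "d = t / (1 - t)"
  have d: "0 < d" using t by (simp add: d_def)
  have Gt: "d ^ N * G t s = lam ^ N * h (d * s)" if "0 \<le> s" for s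
  proof (cases "s = 0")
    case True
    then show ?thesis using N h0 by (simp add: G_def)
  next
    case False
    with that have s: "0 < s" by simp
    have den: "0 < 1 - t + t * s" using t s by (intro add_pos_pos) auto
    define \<theta> where "\<theta> = t * s / (1 - t + t * s)"
    have "0 < \<theta>" "\<theta> < 1" using t s den by (auto simp: \<theta>_def)
    moreover have "\<theta> / (1 - \<theta>) = d * s"
    proof -
      have "1 - \<theta> = (1 - t) / (1 - t + t * s)"
        using den by (simp add: \<theta>_def field_simps)
      then show ?thesis using den t by (simp add: \<theta>_def d_def)
    qed
    ultimately have "\<psi> \<theta> = h (d * s) / (d * s) ^ N" by (simp add: \<psi>_def)
    then show ?thesis
      using s d by (simp add: G_def \<theta>_def[symmetric] power_mult_distrib)
  qed
  have Gc: "continuous_on UNIV (G t)"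
    using G.continuous_on_G_compose[of UNIV "\<lambda>_. t" "\<lambda>s. s"] t by simp
  have wpos: "0 < w r" if "r \<in> {0..<1}" for r
  proof -
    have "w 1 < w r"
      by (rule radial_ivp_strict_antimono[OF N Gc _ _ w])
        (use that t lam \<psi>_pos G.nonneg in \<open>auto simp: G_def\<close>)
    then show ?thesis using w1 by simp
  qed
  show ?thesis
  proof (rule that[of "\<lambda>r. d * w r"])
    fix r :: real assume r: "r \<in> {0..1}"
    have "radial_slope N (\<lambda>s. lam ^ N * h (d * w s)) r = radial_slope N (\<lambda>s. d ^ N * G t (w s)) r"
    proof (rule radial_slope_cong)
      fix s assume "s \<in> {0..r}"
      then have "0 \<le> w s" using wpos[of s] w1 r by (cases "s = 1") (auto intro: less_imp_le)
      then show "lam ^ N * h (d * w s) = d ^ N * G t (w s)" using Gt by simp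
    qed
    also have "\<dots> = d * radial_slope N (\<lambda>s. G t (w s)) r"
      using radial_slope_cmult[OF N] d by simp
    finally have eq: "- radial_slope N (\<lambda>s. lam ^ N * h (d * w s)) r
        = d * (- radial_slope N (\<lambda>s. G t (w s)) r)" by simp
    show "((\<lambda>r. d * w r) has_real_derivative - radial_slope N (\<lambda>s. lam ^ N * h (d * w s)) r)
        (at r within {0..1})"
      unfolding eq by (intro DERIV_cmult radial_ivp_deriv[OF Gc w r])
  qed (use w1 wpos d in auto)
qed

text \<open>The factor \<open>\<sigma>\<close>, which is 1 or -1, treats both signs at once. With
  \<open>u = - \<sigma> * w\<close> one has \<open>- u = \<sigma> * w\<close>, and raising
  \<open>u' = \<sigma> * ?S\<close> to the power \<open>N\<close> brings a second
  \<open>\<sigma> ^ N\<close> that cancels the one in the nonlinearity.\<close>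

lemma radial_solution_imp_MO_solution:
  fixes f :: "real \<Rightarrow> real" and \<sigma> :: real
  assumes N: "N \<ge> 1" and f: "continuous_on UNIV f" and \<sigma>: "\<sigma> * \<sigma> = 1" and lam: "0 < lam"
    and f_pos: "\<And>s. 0 < s \<Longrightarrow> 0 < \<sigma> ^ N * f (\<sigma> * s)"
    and w1: "w 1 = 0" and w_pos: "\<And>r. r \<in> {0..<1} \<Longrightarrow> 0 < w r"
    and der: "\<And>r. r \<in> {0..1} \<Longrightarrow> (w has_real_derivative
      - radial_slope N (\<lambda>s. lam ^ N * (\<sigma> ^ N * f (\<sigma> * w s))) r) (at r within {0..1})"
  shows "MO_solution N f lam (\<lambda>r. - \<sigma> * w r)"
    and "strictly_convex_on {0<..<1} (\<lambda>r. - w r)"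
proof -
  let ?k = "\<lambda>s. lam ^ N * (\<sigma> ^ N * f (\<sigma> * w s))"
  let ?S = "radial_slope N ?k"
  have wc: "continuous_on {0..1} w" by (auto intro!: DERIV_continuous_on der)
  have k: "continuous_on {0..1} ?k"
    by (intro continuous_intros continuous_on_compose2[OF f] wc) auto
  have kpos: "0 < ?k s" if "s \<in> {0..<1}" for s
    using f_pos[OF w_pos[OF that]] lam by simp
  have k0: "0 \<le> ?k s" if "s \<in> {0..1}" for s
    by (rule continuous_ge_on_closure[of "{0<..<1}" ?k])
      (use k kpos that in \<open>auto simp del: mult_pos_pos zero_less_mult_iff intro: less_imp_le\<close>)
  obtain q where q: "continuous_on {0..1} q"
    "\<And>r. r \<in> {0..1} \<Longrightarrow> (?S has_real_derivative q r) (at r within {0..1})"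
    using radial_slope_C1[OF N k kpos] by blast
  have \<sigma>N: "\<sigma> ^ N * \<sigma> ^ N = 1"
    using \<sigma> by (simp flip: power_mult_distrib)
  show "MO_solution N f lam (\<lambda>r. - \<sigma> * w r)"
    unfolding MO_solution_def
  proof (rule exI[of _ "\<lambda>r. \<sigma> * ?S r"], rule exI[of _ "\<lambda>r. \<sigma> * q r"], intro conjI ballI)
    fix r :: real assume r: "r \<in> {0..1}"
    have "((\<lambda>r. - \<sigma> * w r) has_real_derivative - \<sigma> * - ?S r) (at r within {0..1})"
      by (intro DERIV_cmult der r)
    then show "((\<lambda>r. - \<sigma> * w r) has_real_derivative \<sigma> * ?S r) (at r within {0..1})" by simp
    show "((\<lambda>r. \<sigma> * ?S r) has_real_derivative \<sigma> * q r) (at r within {0..1})"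
      by (intro DERIV_cmult q r)
  next
    fix r :: real assume r: "r \<in> {0<..<1}"
    have "((\<lambda>s. \<sigma> ^ N * ?S s ^ N) has_real_derivative \<sigma> ^ N * (real N * r ^ (N - 1) * ?k r)) (at r)"
      by (intro DERIV_cmult radial_slope_power_has_derivative[OF N k k0 r]) auto
    also have "\<sigma> ^ N * (real N * r ^ (N - 1) * ?k r)
        = (\<sigma> ^ N * \<sigma> ^ N) * (lam ^ N * real N * r ^ (N - 1) * f (\<sigma> * w r))"
      by (simp only: ac_simps)
    finally show "((\<lambda>s. (\<sigma> * ?S s) ^ N) has_real_derivative
        lam ^ N * real N * r ^ (N - 1) * f (- (- \<sigma> * w r))) (at r)"
      by (simp add: power_mult_distrib \<sigma>N)
  qed (use q w1 in \<open>auto intro!: continuous_intros\<close>)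
  show "strictly_convex_on {0<..<1} (\<lambda>r. - w r)"
  proof (rule strictly_convex_on_if_deriv_strict_mono)
    show "strict_mono_on {0<..<1} ?S"
      by (rule radial_slope_strict_mono[OF N k kpos])
    fix r :: real assume r: "r \<in> {0<..<1}"
    then have "(w has_real_derivative - ?S r) (at r)"
      using der[of r] by (simp add: at_within_Icc_at)
    from DERIV_minus[OF this] show "((\<lambda>r. - w r) has_real_derivative ?S r) (at r)" by simp
  qed
qed

section \<open>The two solutions from the two signs\<close>

theorem theorem4p1:
  fixes N :: nat and f :: "real \<Rightarrow> real" and f0 finf lam :: real
  assumes N: "N \<ge> 1"
    and f_cont: "continuous_on UNIV f"
    and f_sign: "\<forall>s. s \<noteq> 0 \<longrightarrow> f s * s ^ N > 0"
    and f0_pos: "f0 > 0"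
    and f0_lim: "((\<lambda>s. f s / s ^ N) \<longlongrightarrow> f0 ^ N) (at 0)"
    and finf_pos: "finf > 0"
    and finf_lim: "((\<lambda>s. f s / s ^ N) \<longlongrightarrow> finf ^ N) at_infinity"
    and lam_gt: "lam > min (first_eigenvalue N / finf) (first_eigenvalue N / f0)"
    and lam_lt: "lam < max (first_eigenvalue N / finf) (first_eigenvalue N / f0)"
  shows "\<exists>up um.
           MO_solution N f lam up \<and> (\<forall>r\<in>{0<..<1}. up r > 0) \<and>
           strictly_concave_on {0<..<1} up \<and>
           MO_solution N f lam um \<and> (\<forall>r\<in>{0<..<1}. um r < 0) \<and>
           strictly_convex_on {0<..<1} um"
proof -
  have ev: "0 < first_eigenvalue N" by (rule first_eigenvalue[OF N])
  have "0 < min (first_eigenvalue N / finf) (first_eigenvalue N / f0)"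
    using ev f0_pos finf_pos by simp
  then have lam: "0 < lam" using lam_gt by linarith
  have between: "lam * f0 < first_eigenvalue N \<and> first_eigenvalue N < lam * finf \<or>
      lam * finf < first_eigenvalue N \<and> first_eigenvalue N < lam * f0"
    using lam_gt lam_lt f0_pos finf_pos
    by (auto simp: min_def max_def field_simps split: if_splits)
  have sol: "\<exists>w. MO_solution N f lam (\<lambda>r. - \<sigma> * w r) \<and> (\<forall>r\<in>{0<..<1}. 0 < w r) \<and>
      strictly_convex_on {0<..<1} (\<lambda>r. - w r)" if \<sigma>: "\<sigma> = 1 \<or> \<sigma> = -1" for \<sigma> :: real
  proof -
    define h where "h s = \<sigma> ^ N * f (\<sigma> * s)" for s
    have \<sigma>2: "\<sigma> * \<sigma> = 1" and \<sigma>0: "\<sigma> \<noteq> 0" using \<sigma> by auto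
    then have \<sigma>N: "\<sigma> ^ N * \<sigma> ^ N = 1" by (simp flip: power_mult_distrib)
    have hc: "continuous_on UNIV h"
      unfolding h_def by (intro continuous_intros continuous_on_compose2[OF f_cont]) auto
    have hpos: "0 < h s" if "0 < s" for s
    proof -
      have "0 < f (\<sigma> * s) * (\<sigma> * s) ^ N" using f_sign \<sigma>0 that by simp
      also have "\<dots> = h s * s ^ N" by (simp add: h_def power_mult_distrib)
      finally show ?thesis using that by (simp add: zero_less_mult_iff)
    qed
    \<comment> \<open>Since \<open>\<sigma> ^ N\<close> is its own inverse, the quotient for
      \<open>h\<close> is that of \<open>f\<close> at \<open>\<sigma> * s\<close>; the two-sided
      limits of \<open>f\<close> therefore serve both signs.\<close>
    have ratio: "h s / s ^ N = f (\<sigma> * s) / (\<sigma> * s) ^ N" for s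
    proof -
      have "\<sigma> ^ N = inverse (\<sigma> ^ N)" using \<sigma>N by (simp add: inverse_unique)
      then show ?thesis by (simp add: h_def power_mult_distrib divide_inverse mult_ac)
    qed
    have "filterlim (\<lambda>s. \<sigma> * s) (at 0) (at_right 0)"
    proof -
      have "((\<lambda>s. \<sigma> * s) \<longlongrightarrow> \<sigma> * 0) (at_right 0)" by (intro tendsto_intros)
      then show ?thesis
        using \<sigma>0 unfolding filterlim_at by (auto simp: eventually_at_filter)
    qed
    from filterlim_compose[OF f0_lim this]
    have lim0: "((\<lambda>s. h s / s ^ N) \<longlongrightarrow> f0 ^ N) (at_right 0)" by (simp add: ratio)
    have "filterlim (\<lambda>s. \<sigma> * s) at_infinity at_top"
      using \<sigma>0 by (intro tendsto_mult_filterlim_at_infinity[OF tendsto_const]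
          filterlim_mono[OF filterlim_ident at_top_le_at_infinity]) auto
    from filterlim_compose[OF finf_lim this]
    have liminf: "((\<lambda>s. h s / s ^ N) \<longlongrightarrow> finf ^ N) at_top" by (simp add: ratio)
    obtain w where w: "w 1 = 0" "\<And>r. r \<in> {0..<1} \<Longrightarrow> 0 < w r"
      "\<And>r. r \<in> {0..1} \<Longrightarrow>
        (w has_real_derivative - radial_slope N (\<lambda>s. lam ^ N * h (w s)) r) (at r within {0..1})"
      by (rule positive_radial_solution[OF N hc hpos f0_pos lim0 finf_pos liminf lam between]) blast+
    note mo = radial_solution_imp_MO_solution[OF N f_cont \<sigma>2 lam hpos[unfolded h_def] w[unfolded h_def]]
    show ?thesis
      using mo w(2) by (intro exI[of _ w]) auto
  qed
  \<comment> \<open>The choice \<open>\<sigma> = 1\<close> gives the negative solution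
    \<open>- w\<close>, and \<open>\<sigma> = -1\<close> below gives the positive one,
    \<open>w\<close>.\<close>
  obtain um where um: "MO_solution N f lam (\<lambda>r. - um r)" "\<forall>r\<in>{0<..<1}. 0 < um r"
    "strictly_convex_on {0<..<1} (\<lambda>r. - um r)"
    using sol[of 1] by auto
  obtain up where up: "MO_solution N f lam up" "\<forall>r\<in>{0<..<1}. 0 < up r"
    "strictly_convex_on {0<..<1} (\<lambda>r. - up r)"
    using sol[of "-1"] by auto
  show ?thesis
    by (rule exI[of _ up], rule exI[of _ "\<lambda>r. - um r"])
      (use um up in \<open>auto simp: strictly_concave_on_def\<close>)
qed

end
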